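(* Let $d\in\mathbb N$, use the scaling $\mathfrak s=(1,\dots,1)$, and let $0<\alpha<1<\eta<2$. There exists a constant $C>0$ such that for all $\epsilon>0$ and all centered germs $U$ over $\epsilon\mathbb Z^d$ with $\|U\|_{G^\eta(\epsilon\mathbb Z^d)}<\infty$ it holds $$\|U\|_{G^\eta(\epsilon\mathbb Z^d)}\le C\big([\Delta_\epsilon U]_{G^{\eta-2}(\epsilon\mathbb Z^d)}+[U]_{G^{\eta,\alpha}(\epsilon\mathbb Z^d)}\big).$$
   Context: Distance $d(x,y):=\sum_{i=1}^d|x_i-y_i|$, $B_R(x)$ the corresponding open ball; $\mathcal P_k$ denotes polynomials on $\mathbb R^d$ of degree at most $k$. A germ over $D\subseteq\mathbb R^d$ is a family $U=(U_x)_{x\in D}$ of functions $U_x:D\to\mathbb C$ (continuous; automatic for $D=\epsilon\mathbb Z^d$). For $\eta>0$, $\|U\|_{G^\eta(D)}$ is the infimum of all $M>0$ with $|U_x(y)|\le M\,d(x,y)^\eta$ for all $x,y\in D$. For $0<\alpha<\eta$, $[U]_{G^{\eta,\alpha}(D)}$ is the infimum of all $M>0$ such that for all $x,y\in D$ there is $P\in\mathcal P_{\lfloor\eta\rfloor}$ with $|(U_x-U_y-P)(z)|\le M\,d(y,z)^\alpha(d(x,y)+d(y,z))^{\eta-\alpha}$ for all $z\in D$. The discrete Laplacian is $\Delta_\epsilon u(y):=\epsilon^{-2}\sum_{z\in\epsilon\mathbb Z^d,\,d(y,z)=\epsilon}(u(z)-u(y))$, and $\Delta_\epsilon U:=(\Delta_\epsilon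 U_x)_x$. For $\gamma<0$, let $k:=\lceil|\gamma|\rceil$, let $\mathcal B$ be the set of $\varphi\in C_c^\infty(\mathbb R^d)$ supported in $B_1(0)$ with $\sup_{|\beta|\le k}\sup|\partial^\beta\varphi|\le 1$, and $\varphi_x^\lambda(y):=\lambda^{-d}\varphi((y-x)/\lambda)$. With $\langle f,g\rangle_\epsilon:=\epsilon^d\sum_{x\in\epsilon\mathbb Z^d}f(x)g(x)$, for a family $V=(V_x)_{x\in\epsilon\mathbb Z^d}$ of functions on $\epsilon\mathbb Z^d$ set $[V]_{G^\gamma(\epsilon\mathbb Z^d)}:=\sup_{\varphi\in\mathcal B}\sup_{x\in\epsilon\mathbb Z^d,\,\lambda\ge\epsilon}\lambda^{-\gamma}|\langle V_x,\varphi_x^\lambda\rangle_\epsilon|$. A germ $U$ over $\epsilon\mathbb Z^d$ is centered if $U_x(x)=0$ and $D_jU_x(x)=0$ for all $x\in\epsilon\mathbb Z^d$, $j\in\{1,\dots,d\}$, where $D_jU_x(x):=\epsilon^{-1}(U_x(x+\epsilon\mathbf e_j)-U_x(x))$. *)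

theory Defs
  imports "HOL-Analysis.Analysis"
begin

definition l1dist :: "real^'d \<Rightarrow> real^'d \<Rightarrow> real" where
  "l1dist x y = (\<Sum>i\<in>UNIV. \<bar>x$i - y$i\<bar>)"

definition lattice :: "real \<Rightarrow> (real^'d) set" where
  "lattice \<epsilon> = {x. \<forall>i. \<exists>k::int. x$i = \<epsilon> * of_int k}"

definition poly_le :: "nat \<Rightarrow> (real^'d \<Rightarrow> complex) \<Rightarrow> bool" where
  "poly_le k P \<longleftrightarrow> (\<exists>c :: ('d \<Rightarrow> nat) \<Rightarrow> complex.
     P = (\<lambda>z. \<Sum>\<beta>\<in>{\<beta>::'d\<Rightarrow>nat. (\<Sum>i\<in>UNIV. \<beta> i) \<le> k}.
                c \<beta> * (\<Prod>i\<in>UNIV. (complex_of_real (z$i)) ^ (\<beta> i))))"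

text \<open>Germs: U x is the function U_x. Only values on the domain D matter.\<close>

definition germ_norm :: "(real^'d) set \<Rightarrow> real \<Rightarrow> (real^'d \<Rightarrow> real^'d \<Rightarrow> complex) \<Rightarrow> ereal" where
  "germ_norm D \<eta> U = Inf {ereal M | M. M > 0 \<and>
     (\<forall>x\<in>D. \<forall>y\<in>D. cmod (U x y) \<le> M * l1dist x y powr \<eta>)}"

definition germ_hoelder :: "(real^'d) set \<Rightarrow> real \<Rightarrow> real \<Rightarrow> (real^'d \<Rightarrow> real^'d \<Rightarrow> complex) \<Rightarrow> ereal" where
  "germ_hoelder D \<eta> \<alpha> U = Inf {ereal M | M. M > 0 \<and>
     (\<forall>x\<in>D. \<forall>y\<in>D. \<exists>P. poly_le (nat \<lfloor>\<eta>\<rfloor>) P \<and>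
        (\<forall>z\<in>D. cmod (U x z - U y z - P z)
              \<le> M * l1dist y z powr \<alpha> * (l1dist x y + l1dist y z) powr (\<eta> - \<alpha>)))}"

definition disc_lap :: "real \<Rightarrow> (real^'d \<Rightarrow> complex) \<Rightarrow> real^'d \<Rightarrow> complex" where
  "disc_lap \<epsilon> u y = complex_of_real (\<epsilon> powi (-2)) *
     (\<Sum>z\<in>{z\<in>lattice \<epsilon>. l1dist y z = \<epsilon>}. u z - u y)"

definition germ_lap :: "real \<Rightarrow> (real^'d \<Rightarrow> real^'d \<Rightarrow> complex) \<Rightarrow> real^'d \<Rightarrow> real^'d \<Rightarrow> complex" where
  "germ_lap \<epsilon> U = (\<lambda>x. disc_lap \<epsilon> (U x))"

definition partial :: "'d \<Rightarrow> (real^'d \<Rightarrow> real) \<Rightarrow> real^'d \<Rightarrow> real" where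
  "partial i f = (\<lambda>x. frechet_derivative f (at x) (axis i 1))"

definition iter_partial :: "'d list \<Rightarrow> (real^'d \<Rightarrow> real) \<Rightarrow> real^'d \<Rightarrow> real" where
  "iter_partial is f = foldr partial is f"

definition smooth_fn :: "(real^'d \<Rightarrow> real) \<Rightarrow> bool" where
  "smooth_fn f \<longleftrightarrow> (\<forall>is. (\<forall>x. iter_partial is f differentiable (at x)))"

definition test_class :: "real \<Rightarrow> (real^'d \<Rightarrow> real) set" where
  "test_class \<gamma> = {\<phi>. smooth_fn \<phi> \<and> compact (closure {x. \<phi> x \<noteq> 0}) \<and>
      closure {x. \<phi> x \<noteq> 0} \<subseteq> {x. l1dist 0 x < 1} \<and>
      (\<forall>is. length is \<le> nat \<lceil>\<bar>\<gamma>\<bar>\<rceil> \<longrightarrow> (\<forall>x. \<bar>iter_partial is \<phi> x\<bar> \<le> 1))}"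

definition rescale :: "(real^'d \<Rightarrow> real) \<Rightarrow> real^'d \<Rightarrow> real \<Rightarrow> real^'d \<Rightarrow> real" where
  "rescale \<phi> x r = (\<lambda>y. r powi (- int CARD('d)) * \<phi> ((1 / r) *\<^sub>R (y - x)))"

definition disc_pair :: "real \<Rightarrow> (real^'d \<Rightarrow> complex) \<Rightarrow> (real^'d \<Rightarrow> real) \<Rightarrow> complex" where
  "disc_pair \<epsilon> f g = complex_of_real (\<epsilon> ^ CARD('d)) *
     (\<Sum>\<^sub>\<infinity>x\<in>lattice \<epsilon>. f x * complex_of_real (g x))"

definition germ_neg :: "real \<Rightarrow> real \<Rightarrow> (real^'d \<Rightarrow> real^'d \<Rightarrow> complex) \<Rightarrow> ereal" where
  "germ_neg \<epsilon> \<gamma> V = Sup {ereal (r powr (-\<gamma>) * cmod (disc_pair \<epsilon> (V x) (rescale \<phi> x r))) | \<phi> x r.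
      \<phi> \<in> test_class \<gamma> \<and> x \<in> lattice \<epsilon> \<and> r \<ge> \<epsilon>}"

definition centered :: "real \<Rightarrow> (real^'d \<Rightarrow> real^'d \<Rightarrow> complex) \<Rightarrow> bool" where
  "centered \<epsilon> U \<longleftrightarrow> (\<forall>x\<in>lattice \<epsilon>. U x x = 0 \<and>
     (\<forall>j. (U x (x + \<epsilon> *\<^sub>R axis j 1) - U x x) / complex_of_real \<epsilon> = 0))"

end

theory Submission
  imports Defs "HOL-Computational_Algebra.Polynomial"
begin

text \<open>The argument is direct (no compactness). Work on \<open>\<int>\<^sup>d\<close> and fix a scale \<open>R \<ge> 1\<close>. Mollify \<open>u = U\<^sub>x\<close> at
  scale \<open>s = max (\<delta> R) 1\<close> with a rescaled test function. Near \<open>y\<close>, \<open>u\<close> is \<open>U\<^sub>y\<close> plus an affine function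
  plus a Hoelder error, so on the ball of radius \<open>R\<close> the mollified function \<open>w\<close> differs from \<open>u\<close> by at most
  \<open>(N \<delta>\<^sup>\<eta> + C H) R\<^sup>\<eta>\<close>, where \<open>N\<close> is the a priori constant, while \<open>\<bar>\<Delta>w\<bar> \<le> C (K + H) R\<^bsup>\<eta> - 2\<^esup>\<close> on the larger
  ball of radius of order \<open>L R\<close>, with \<open>C\<close> depending on \<open>\<delta>\<close> and \<open>L\<close>. After solving a Dirichlet problem,
  second-difference estimates for discrete harmonic functions show that \<open>w\<close> is affine on the small ball up
  to \<open>(C N L\<^bsup>\<eta> - 2\<^esup> + C (K + H)) R\<^sup>\<eta>\<close>, where the first \<open>C\<close> does not depend on \<open>\<delta>\<close> and \<open>L\<close>. Since \<open>\<eta> > 1\<close>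
  and the germ is centered, the affine approximations at dyadic scales sum up to a bound
  \<open>\<bar>u\<bar> \<le> (\<theta> N + C (K + H)) \<bar>y - x\<bar>\<^sup>\<eta>\<close> with \<open>\<theta>\<close> small, and \<open>\<theta> N\<close> is absorbed because \<open>N\<close> is finite.\<close>

section \<open>Harmonic functions on the integer lattice\<close>

text \<open>The obstacle is that the Laplacian of \<open>U x\<close> is tested only against
  functions centred at \<open>x\<close> itself. To bound the Laplacian of the mollified
  \<open>U x\<close> at another point y, one passes to the germ based at y, and pays with a Hoelder
  error that grows with the distance from x to y. The two parameters remove two different losses.
  Mollifying at the full scale R would cost a fixed multiple of N R^\<eta>, which cannot be
  absorbed; the factor \<delta> makes this cost small. The harmonic part has size of order N (L
  R)^\<eta>, and its second differences gain (L R)^(-2); over a ball of radius R this leaves the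
  power L^(\<eta> - 2), small because \<eta> < 2. Making \<delta> small and L large only worsens the
  coefficient of K + H. Since 0 < 2 - \<eta> < 1, admissible test functions need control of
  derivatives of order at most one. Complex germs are handled through real and imaginary parts; each
  part yields N/4, so that N/2 remains to be absorbed.\<close>

definition znorm :: "int^'d \<Rightarrow> nat" where
  "znorm z = (\<Sum>i\<in>UNIV. nat \<bar>z$i\<bar>)"

definition zunit :: "'d \<Rightarrow> int^'d" where
  "zunit j = axis j 1"

definition zlap :: "(int^'d \<Rightarrow> 'a::ring_1) \<Rightarrow> int^'d \<Rightarrow> 'a" where
  "zlap u y = (\<Sum>j\<in>UNIV. u (y + zunit j) + u (y - zunit j) - 2 * u y)"

lemma zunit_nth: "zunit j $ i = (if i = j then 1 else 0)"
  by (simp add: zunit_def axis_def)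

lemma znorm_0 [simp]: "znorm 0 = 0"
  by (simp add: znorm_def)

lemma znorm_minus [simp]: "znorm (- z) = znorm z"
  by (simp add: znorm_def)

lemma znorm_minus_commute: "znorm (a - b) = znorm (b - a)"
  by (metis minus_diff_eq znorm_minus)

lemma znorm_triangle: "znorm (a + b) \<le> znorm a + znorm b"
  unfolding znorm_def sum.distrib[symmetric] by (intro sum_mono) auto

lemma znorm_triangle_diff: "znorm (a - b) \<le> znorm a + znorm b"
  using znorm_triangle[of a "- b"] by simp

lemma znorm_unit [simp]: "znorm (zunit j :: int^'d) = 1"
proof -
  have "znorm (zunit j :: int^'d) = (\<Sum>i\<in>UNIV. if i = j then 1 else 0)"
    unfolding znorm_def by (intro sum.cong) (auto simp: zunit_nth)
  then show ?thesis by simp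
qed

lemma znorm_eq_0_iff [simp]: "znorm z = 0 \<longleftrightarrow> z = 0"
  by (auto simp: znorm_def vec_eq_iff)

lemma component_le_znorm: "\<bar>z$i\<bar> \<le> int (znorm z)"
proof -
  have "nat \<bar>z$i\<bar> \<le> znorm z"
    unfolding znorm_def by (rule member_le_sum) auto
  then show ?thesis by linarith
qed

lemma real_znorm: "real (znorm z) = (\<Sum>i\<in>UNIV. \<bar>real_of_int (z$i)\<bar>)"
  by (simp add: znorm_def)

lemma znorm_le_box:
  fixes z :: "int^'d"
  assumes "\<And>i. \<bar>z$i\<bar> \<le> int m"
  shows "znorm z \<le> CARD('d) * m"
proof -
  have "znorm z \<le> (\<Sum>i\<in>(UNIV::'d set). m)"
    unfolding znorm_def by (intro sum_mono) (use assms in \<open>simp add: nat_le_iff\<close>)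
  then show ?thesis by simp
qed

lemma zbox:
  assumes "finite A"
  shows "finite {z::int^'d. \<forall>i. z$i \<in> A}" "card {z::int^'d. \<forall>i. z$i \<in> A} = card A ^ CARD('d)"
proof -
  have bij: "bij_betw vec_lambda (PiE (UNIV::'d set) (\<lambda>_. A)) {z::int^'d. \<forall>i. z$i \<in> A}"
    by (rule bij_betw_byWitness[where f'=vec_nth]) auto
  have "finite (PiE (UNIV::'d set) (\<lambda>_. A))"
    using assms by (intro finite_PiE) auto
  then show "finite {z::int^'d. \<forall>i. z$i \<in> A}"
    using bij_betw_finite[OF bij] by simp
  show "card {z::int^'d. \<forall>i. z$i \<in> A} = card A ^ CARD('d)"
    using bij_betw_same_card[OF bij] by (simp add: card_PiE)
qed

lemma finite_zball: "finite {z::int^'d. znorm z \<le> n}"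
proof (rule finite_subset)
  show "{z::int^'d. znorm z \<le> n} \<subseteq> {z. \<forall>i. z$i \<in> {- int n .. int n}}"
  proof safe
    fix z :: "int^'d" and i assume "znorm z \<le> n"
    then show "z$i \<in> {- int n .. int n}" using component_le_znorm[of z i] by auto
  qed
qed (rule zbox, simp)

section \<open>Discrete Laplacian, barriers and the gradient estimate\<close>

lemma zlap_diff: "zlap (\<lambda>z. f z - g z) y = zlap f y - zlap g y"
  by (simp add: zlap_def sum_subtractf[symmetric] algebra_simps)

lemma zlap_shift: "zlap (\<lambda>z. f (c + z)) y = zlap f (c + y)"
  by (simp add: zlap_def algebra_simps)

lemma zlap_nonpos_max:
  fixes f :: "int^'d \<Rightarrow> real"
  assumes "\<And>i. f (p + zunit i) \<le> f p" "\<And>i. f (p - zunit i) \<le> f p"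
  shows "zlap f p \<le> 0"
  unfolding zlap_def by (rule sum_nonpos) (use assms in \<open>smt (verit)\<close>)

text \<open>The squared Euclidean norm. Its discrete Laplacian is the constant
  \<open>2 * CARD('d)\<close>, which makes it the building block of all barriers below.\<close>

definition zsq :: "int^'d \<Rightarrow> real" where
  "zsq y = (\<Sum>k\<in>UNIV. (real_of_int (y$k))\<^sup>2)"

lemma zsq_add: "zsq (y + zunit i) = zsq y + 2 * real_of_int (y$i) + 1"
proof -
  have "zsq (y + zunit i) = (\<Sum>k\<in>UNIV. (real_of_int (y$k))\<^sup>2 + (if k = i then 2 * real_of_int (y$k) + 1 else 0))"
    unfolding zsq_def by (intro sum.cong) (auto simp: zunit_nth power2_eq_square algebra_simps)
  then show ?thesis by (simp add: zsq_def sum.distrib)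
qed

lemma zsq_diff: "zsq (y - zunit i) = zsq y - 2 * real_of_int (y$i) + 1"
  using zsq_add[of "y - zunit i" i] by (simp add: zunit_nth)

lemma zsq_le_znorm: "zsq y \<le> (real (znorm y))\<^sup>2"
proof -
  have "zsq y = (\<Sum>k\<in>UNIV. \<bar>real_of_int (y$k)\<bar> * \<bar>real_of_int (y$k)\<bar>)"
    by (simp add: zsq_def power2_eq_square)
  also have "\<dots> \<le> (\<Sum>k\<in>UNIV. \<bar>real_of_int (y$k)\<bar> * real (znorm y))"
  proof (intro sum_mono mult_left_mono)
    fix k show "\<bar>real_of_int (y$k)\<bar> \<le> real (znorm y)"
      using component_le_znorm[of y k] by linarith
  qed auto
  finally show ?thesis by (simp add: sum_distrib_right[symmetric] real_znorm[symmetric] power2_eq_square)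
qed

lemma zsq_nonneg: "zsq y \<ge> 0"
  by (simp add: zsq_def sum_nonneg)

lemma zsq_ge_component: "(real_of_int (y$i))\<^sup>2 \<le> zsq y"
  unfolding zsq_def by (rule member_le_sum) auto

text \<open>The map \<open>R j\<close> preserves the lattice, interchanges 0 and
  \<open>zunit j\<close>, and only swaps the two neighbours in direction j, so it commutes with the
  Laplacian.\<close>

lemma zlap_reflect:
  fixes h :: "int^'d \<Rightarrow> real"
  defines "R \<equiv> \<lambda>j (y::int^'d). (\<chi> i. if i = j then 1 - y$i else y$i)"
  shows "zlap (\<lambda>y. h (R j y)) p = zlap h (R j p)"
proof -
  have 1: "R j (p + zunit i) = (if i = j then R j p - zunit i else R j p + zunit i)" for i
    by (auto simp: R_def vec_eq_iff zunit_nth)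
  have 2: "R j (p - zunit i) = (if i = j then R j p + zunit i else R j p - zunit i)" for i
    by (auto simp: R_def vec_eq_iff zunit_nth)
  show ?thesis unfolding zlap_def by (intro sum.cong) (auto simp: 1 2)
qed

text \<open>The difference of \<open>h\<close> and its reflection in the hyperplane \<open>y\<^sub>j = 1/2\<close> is harmonic and
  odd, so it lies below a quadratic barrier which is linear in \<open>y\<^sub>j\<close> near the hyperplane.\<close>

lemma harmonic_difference_le:
  fixes h :: "int^'d \<Rightarrow> real"
  assumes m: "m \<ge> 1" and M: "M > 0"
    and bd: "\<And>y. znorm y \<le> CARD('d) * m \<Longrightarrow> \<bar>h y\<bar> \<le> M"
    and harm: "\<And>y. znorm y \<le> CARD('d) * m \<Longrightarrow> zlap h y = 0"
  shows "h (zunit j) - h 0 \<le> 2 * M * (real CARD('d) + 1) / real m"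
proof (rule ccontr)
  assume neg: "\<not> ?thesis"
  define d where "d = real CARD('d)"
  define R where "R = (\<lambda>(y::int^'d). (\<chi> i. if i = j then 1 - y$i else y$i) :: int^'d)"
  define g where "g y = h y - h (R y)" for y
  define t where "t y = real_of_int (y$j)" for y :: "int^'d"
  \<comment> \<open>The prefactor makes \<open>b\<close> at least 2 M on the outer faces, where
    \<open>zsq\<close> is at least m^2. The weight d + 1 turns the Laplacian of the bracket into 2 d
    - 2 (d + 1) = -2, while the linear term keeps \<open>b\<close> of order M / m at
    \<open>zunit j\<close>.\<close>
  define b where "b y = 2 * M / (real m)\<^sup>2 * (zsq y + (d + 1) * (real m * t y - (t y)\<^sup>2))" for y
  define f where "f y = g y - b y" for y
  define D where "D = {y::int^'d. 1 \<le> y$j \<and> (\<forall>i. \<bar>y$i\<bar> \<le> int m)}"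
  have d1: "d \<ge> 1" unfolding d_def by (simp add: Suc_leI)
  have fin: "finite D"
    by (rule finite_subset[OF _ finite_zball[of "CARD('d) * m"]]) (auto simp: D_def intro: znorm_le_box)
  have eD: "zunit j \<in> D" using m by (auto simp: D_def zunit_nth)
  have inball: "\<bar>h y\<bar> \<le> M" "zlap h y = 0" if "\<And>i. \<bar>y$i\<bar> \<le> int m" for y
    using bd harm znorm_le_box[of y m] that by auto
  have RR: "R (R y) = y" for y by (simp add: R_def vec_eq_iff)
  have Rbox: "\<bar>R y $ i\<bar> \<le> int m" if "0 \<le> y$j" "\<And>i. \<bar>y$i\<bar> \<le> int m" for y i
    using that(2)[of i] that(2)[of j] that(1) m by (cases "i = j") (auto simp: R_def)
  have g2: "g y \<le> 2 * M" if "0 \<le> y$j" "\<And>i. \<bar>y$i\<bar> \<le> int m" for y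
    using inball(1)[OF that(2)] inball(1)[OF Rbox[OF that]] unfolding g_def by linarith
  have bnn: "b y \<ge> 0" if "0 \<le> y$j" "y$j \<le> int m" for y
  proof -
    have "real m * t y - (t y)\<^sup>2 = t y * (real m - t y)" by (simp add: power2_eq_square algebra_simps)
    moreover have "0 \<le> t y" "t y \<le> real m" using that by (auto simp: t_def)
    ultimately have "real m * t y - (t y)\<^sup>2 \<ge> 0" by simp
    then show ?thesis unfolding b_def using M d1 zsq_nonneg[of y] by simp
  qed
  have bbig: "b y \<ge> 2 * M" if "0 \<le> y$j" "y$j \<le> int m" "\<bar>y$i\<bar> = int m" for y i
  proof -
    have "real m * t y - (t y)\<^sup>2 = t y * (real m - t y)" by (simp add: power2_eq_square algebra_simps)
    moreover have "0 \<le> t y" "t y \<le> real m" using that by (auto simp: t_def)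
    ultimately have "(d + 1) * (real m * t y - (t y)\<^sup>2) \<ge> 0" using d1 by simp
    moreover have "zsq y \<ge> (real m)\<^sup>2"
    proof -
      have "\<bar>real_of_int (y$i)\<bar> = real m" using that(3) by linarith
      then have "(real_of_int (y$i))\<^sup>2 = (real m)\<^sup>2" by (metis power2_abs)
      then show ?thesis using zsq_ge_component[of y i] by simp
    qed
    ultimately have "zsq y + (d + 1) * (real m * t y - (t y)\<^sup>2) \<ge> (real m)\<^sup>2" by linarith
    then have "b y \<ge> 2 * M / (real m)\<^sup>2 * (real m)\<^sup>2"
      unfolding b_def using M by (intro mult_left_mono) auto
    then show ?thesis using m by simp
  qed
  have "b (zunit j) \<le> 2 * M * (d + 1) / real m"
  proof -
    have z: "zsq (zunit j :: int^'d) = 1" using zsq_add[of 0 j] by (simp add: zsq_def)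
    have "1 + (d + 1) * (real m - 1) \<le> (d + 1) * real m" using d1 by (simp add: algebra_simps)
    then have "b (zunit j) \<le> 2 * M / (real m)\<^sup>2 * ((d + 1) * real m)"
      unfolding b_def using M z by (intro mult_left_mono) (auto simp: t_def zunit_nth)
    then show ?thesis using m by (simp add: power2_eq_square divide_simps)
  qed
  moreover have "R (zunit j) = 0" by (auto simp: R_def vec_eq_iff zunit_nth)
  ultimately have fe: "f (zunit j) > 0" using neg by (simp add: f_def g_def d_def)
  obtain p where p: "p \<in> D" "\<And>y. y \<in> D \<Longrightarrow> f y \<le> f p"
    using finite_has_maximal[of "f ` D"] fin eD
    by (metis (mono_tags, lifting) Max_ge Max_in empty_iff finite_imageI image_iff image_is_empty)
  have fp: "f p > 0" using p(2)[OF eD] fe by linarith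
  have pb: "1 \<le> p$j" "\<And>i. \<bar>p$i\<bar> \<le> int m" using p(1) by (auto simp: D_def)
  have pj: "0 \<le> p$j" "p$j \<le> int m" using pb(1) pb(2)[of j] by auto
  \<comment> \<open>On an outer face \<open>b\<close> dominates \<open>g\<close>, so a point with
    \<open>f\<close> positive stays away from these faces and all its neighbours lie in the
    box.\<close>
  have pi: "\<bar>p$i\<bar> < int m" for i
  proof (rule ccontr)
    assume "\<not> ?thesis"
    then have "\<bar>p$i\<bar> = int m" using pb(2)[of i] by simp
    then show False using bbig[OF pj] g2[OF pj(1) pb(2)] fp by (force simp: f_def)
  qed
  \<comment> \<open>The only way to leave \<open>D\<close> from \<open>p\<close> is across the
    hyperplane, and then the neighbour is the mirror image of \<open>p\<close>. There
    \<open>g\<close> changes sign, so \<open>f\<close> is not positive.\<close>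
  have nb: "f q \<le> f p" if q: "q = p + zunit i \<or> q = p - zunit i" for q i
  proof (cases "q \<in> D")
    case False
    have "\<bar>q$k\<bar> \<le> int m" for k using q pi[of k] by (auto simp: zunit_nth)
    then have "q$j < 1" using False by (auto simp: D_def)
    then have "i = j" "q = p - zunit i" "p$j = 1" using q pb(1) by (auto simp: zunit_nth split: if_splits)
    then have "q = R p" by (auto simp: R_def vec_eq_iff zunit_nth)
    then have "g q = - g p" by (simp add: g_def RR)
    moreover have "b q \<ge> 0" using \<open>q = R p\<close> \<open>p$j = 1\<close> by (intro bnn) (auto simp: R_def)
    moreover have "b p \<ge> 0" by (rule bnn[OF pj])
    ultimately show ?thesis using fp by (simp add: f_def)
  qed (rule p(2))
  have "zlap f p \<le> 0" by (rule zlap_nonpos_max) (auto intro: nb)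
  moreover have "zlap g p = 0"
    using inball(2)[OF pb(2)] inball(2)[of "R p"] Rbox[OF pj(1) pb(2)] zlap_reflect[of h j p]
    unfolding g_def by (simp add: zlap_diff R_def)
  moreover have "zlap b p < 0"
  proof -
    have "b (p + zunit i) + b (p - zunit i) - 2 * b p = 2 * M / (real m)\<^sup>2 * (2 + (if i = j then - 2 * (d + 1) else 0))" for i
    proof -
      define q where "q = 2 * M / (real m)\<^sup>2"
      show ?thesis unfolding b_def q_def[symmetric]
        by (auto simp: zsq_add zsq_diff t_def zunit_nth power2_eq_square algebra_simps)
    qed
    then have "zlap b p = 2 * M / (real m)\<^sup>2 * (\<Sum>i\<in>UNIV. 2 + (if i = j then - 2 * (d + 1) else 0))"
      unfolding zlap_def by (simp add: sum_distrib_left)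
    also have "(\<Sum>i\<in>(UNIV::'d set). 2 + (if i = j then - 2 * (d + 1) else 0)) = - 2"
      by (simp add: sum.distrib d_def)
    finally show ?thesis using M m by simp
  qed
  moreover have "zlap f p = zlap g p - zlap b p"
    using zlap_diff[of g b p] by (simp add: f_def[abs_def])
  ultimately show False by linarith
qed


lemma harmonic_gradient:
  fixes h :: "int^'d \<Rightarrow> real"
  assumes m: "m \<ge> 1" and M: "M > 0"
    and bd: "\<And>y. znorm (y - c) \<le> CARD('d) * m \<Longrightarrow> \<bar>h y\<bar> \<le> M"
    and harm: "\<And>y. znorm (y - c) \<le> CARD('d) * m \<Longrightarrow> zlap h y = 0"
  shows "\<bar>h (c + zunit j) - h c\<bar> \<le> 2 * M * (real CARD('d) + 1) / real m"
proof -
  have bd': "\<bar>h (c + y)\<bar> \<le> M" and harm': "zlap h (c + y) = 0" if "znorm y \<le> CARD('d) * m" for y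
    using bd[of "c + y"] harm[of "c + y"] that by auto
  have "zlap (\<lambda>y. - h (c + y)) y = - zlap h (c + y)" for y
    using zlap_diff[of "\<lambda>_. 0" "\<lambda>y. h (c + y)" y] by (simp add: zlap_shift) (simp add: zlap_def)
  then have "- h (c + zunit j) - (- h (c + 0)) \<le> 2 * M * (real CARD('d) + 1) / real m"
    using m M bd' harm' by (intro harmonic_difference_le[where h = "\<lambda>y. - h (c + y)"]) auto
  moreover have "h (c + zunit j) - h (c + 0) \<le> 2 * M * (real CARD('d) + 1) / real m"
    using m M bd' harm' by (intro harmonic_difference_le[where h = "\<lambda>y. h (c + y)"]) (auto simp: zlap_shift)
  ultimately show ?thesis by simp
qed

section \<open>Affine approximation of harmonic functions and of solutions of the Poisson
  equation\<close>

lemma znorm_pred: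
  fixes z :: "int^'d"
  assumes "z$j > 0"
  shows "znorm z = Suc (znorm (z - zunit j))"
proof -
  have "znorm z = nat \<bar>z$j\<bar> + (\<Sum>i\<in>UNIV-{j}. nat \<bar>z$i\<bar>)"
    unfolding znorm_def by (rule sum.remove) auto
  moreover have "znorm (z - zunit j) = nat \<bar>(z - zunit j)$j\<bar> + (\<Sum>i\<in>UNIV-{j}. nat \<bar>(z - zunit j)$i\<bar>)"
    unfolding znorm_def by (rule sum.remove) auto
  moreover have "(\<Sum>i\<in>UNIV-{j}. nat \<bar>(z - zunit j)$i\<bar>) = (\<Sum>i\<in>UNIV-{j}. nat \<bar>z$i\<bar>)"
    by (intro sum.cong) (auto simp: zunit_nth)
  moreover have "nat \<bar>z$j\<bar> = Suc (nat \<bar>(z - zunit j)$j\<bar>)"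
    using assms by (auto simp: zunit_nth)
  ultimately show ?thesis by linarith
qed

text \<open>Moving a nonzero coordinate one step towards 0 lowers \<open>znorm\<close> by one; a
  path of \<open>znorm z\<close> unit steps thus joins \<open>z\<close> to 0 without leaving the
  ball.\<close>

lemma lattice_path_bound:
  fixes f :: "int^'d \<Rightarrow> real"
  assumes step: "\<And>z j. znorm z \<le> n \<Longrightarrow> znorm (z + zunit j) \<le> n \<Longrightarrow> \<bar>f (z + zunit j) - f z\<bar> \<le> E"
    and z: "znorm z \<le> n"
  shows "\<bar>f z - f 0\<bar> \<le> E * real (znorm z)"
  using z
proof (induction "znorm z" arbitrary: z)
  case 0
  then show ?case by simp
next
  case (Suc k)
  obtain z' j where z': "znorm z' = k" "z = z' + zunit j \<or> z' = z + zunit j"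
  proof -
    have "z \<noteq> 0" using Suc by auto
    then obtain j where "z$j \<noteq> 0" by (auto simp: vec_eq_iff)
    then consider "z$j > 0" | "(-z)$j > 0" by fastforce
    then show thesis
    proof cases
      case 1
      then show thesis using znorm_pred[OF 1] Suc.hyps(2) that[of "z - zunit j" j] by simp
    next
      case 2
      have "- z - zunit j = - (z + zunit j)" by simp
      then have "znorm (- z - zunit j) = znorm (z + zunit j)" by (metis znorm_minus)
      then show thesis using znorm_pred[OF 2] Suc.hyps(2) that[of "z + zunit j" j] by simp
    qed
  qed
  have "\<bar>f z' - f 0\<bar> \<le> E * real k" using Suc.hyps(1)[of z'] z' Suc.prems Suc.hyps(2) by simp
  moreover have "\<bar>f z - f z'\<bar> \<le> E"
    using z'(2)
  proof
    assume "z = z' + zunit j"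
    then show ?thesis using step[of z' j] z' Suc by simp
  next
    assume "z' = z + zunit j"
    then show ?thesis using step[of z j] z' Suc by simp
  qed
  ultimately have "\<bar>f z - f 0\<bar> \<le> E * real k + E" by linarith
  then show ?case using Suc.hyps(2)[symmetric] by (simp add: algebra_simps)
qed

text \<open>The gradient estimate is used twice: first differences of \<open>h\<close> are again
  harmonic and of size M / m, so second differences are of size M / m^2. Each use consumes a layer
  of thickness \<open>CARD('d) * m\<close>, which explains the radius 3. The slopes are the forward
  differences at 0, hence one \<open>b\<close> serves every radius \<open>r\<close>.\<close>

lemma harmonic_affine_approx:
  fixes h :: "int^'d \<Rightarrow> real"
  assumes m: "m \<ge> 1" and M: "M > 0"
    and bd: "\<And>y. znorm y \<le> 3 * CARD('d) * m \<Longrightarrow> \<bar>h y\<bar> \<le> M"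
    and harm: "\<And>y. znorm y \<le> 3 * CARD('d) * m \<Longrightarrow> zlap h y = 0"
  shows "\<exists>b. \<forall>r\<le>CARD('d) * m. \<forall>y. znorm y \<le> r \<longrightarrow>
     \<bar>h y - h 0 - (\<Sum>j\<in>UNIV. b j * real_of_int (y$j))\<bar> \<le> 4 * (real CARD('d) + 1)\<^sup>2 * M * (real r / real m)\<^sup>2"
proof (intro exI allI impI)
  define d where "d = CARD('d)"
  define M1 where "M1 = 2 * M * (real d + 1) / real m"
  define E where "E = 2 * M1 * (real d + 1) / real m"
  define D where "D j y = h (y + zunit j) - h y" for j y
  define b where "b j = D j 0" for j
  fix r and y :: "int^'d"
  assume r: "r \<le> CARD('d) * m" and y: "znorm y \<le> r"
  have d1: "d \<ge> 1" unfolding d_def by (simp add: Suc_leI)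
  have dm: "d * m \<ge> 1" using d1 m by (metis mult_le_mono nat_mult_1)
  have M1: "M1 > 0" unfolding M1_def using M m by (simp add: add_pos_nonneg)
  have D1: "\<bar>D j z\<bar> \<le> M1" if "znorm z \<le> 2 * d * m" for j z
    unfolding D_def M1_def d_def
  proof (rule harmonic_gradient[OF m M])
    fix w :: "int^'d" assume "znorm (w - z) \<le> CARD('d) * m"
    then have "znorm w \<le> 3 * CARD('d) * m"
      using that znorm_triangle[of "w - z" z] by (simp add: d_def)
    then show "\<bar>h w\<bar> \<le> M" "zlap h w = 0" using bd harm by auto
  qed
  have D2: "\<bar>D j (z + zunit i) - D j z\<bar> \<le> E" if "znorm z \<le> d * m" for i j z
    unfolding E_def d_def
  proof (rule harmonic_gradient[OF m M1])
    fix w :: "int^'d" assume "znorm (w - z) \<le> CARD('d) * m"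
    then have w: "znorm w \<le> 2 * d * m"
      using that znorm_triangle[of "w - z" z] by (simp add: d_def)
    then show "\<bar>D j w\<bar> \<le> M1" by (rule D1)
    have "zlap (D j) w = zlap h (w + zunit j) - zlap h w"
      using zlap_shift[of h "zunit j" w] unfolding D_def by (simp add: zlap_diff add.commute)
    \<comment> \<open>The extra unit step fits into the third layer because d m is at least
      1.\<close>
    moreover have "znorm (w + zunit j) \<le> 3 * CARD('d) * m"
    proof -
      have "3 * CARD('d) * m = 3 * (d * m)" "znorm w \<le> 2 * (d * m)" using w by (simp_all add: d_def mult.assoc)
      then show ?thesis using znorm_triangle[of w "zunit j"] dm znorm_unit[of j] by linarith
    qed
    moreover have "znorm w \<le> 3 * CARD('d) * m" using w by (simp add: d_def)
    ultimately show "zlap (D j) w = 0" using harm by simp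
  qed
  have E: "E \<ge> 0" unfolding E_def using M1 by simp
  define k where "k z = h z - (\<Sum>j\<in>UNIV. b j * real_of_int (z$j))" for z
  have "\<bar>k y - k 0\<bar> \<le> E * real r * real (znorm y)"
  proof (rule lattice_path_bound[OF _ y])
    fix z :: "int^'d" and j assume z: "znorm z \<le> r" "znorm (z + zunit j) \<le> r"
    have "\<bar>D j z - D j 0\<bar> \<le> E * real (znorm z)"
      by (rule lattice_path_bound[of r]) (use z r D2 in \<open>auto simp: d_def\<close>)
    also have "\<dots> \<le> E * real r" using z E by (intro mult_left_mono) auto
    finally have "\<bar>D j z - b j\<bar> \<le> E * real r" by (simp add: b_def)
    moreover have "(\<Sum>i\<in>UNIV. b i * real_of_int ((z + zunit j)$i)) = (\<Sum>i\<in>UNIV. b i * real_of_int (z$i) + (if i = j then b i else 0))"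
      by (intro sum.cong) (auto simp: zunit_nth algebra_simps)
    then have "k (z + zunit j) - k z = D j z - b j"
      by (simp add: k_def D_def sum.distrib)
    ultimately show "\<bar>k (z + zunit j) - k z\<bar> \<le> E * real r" by simp
  qed
  also have "\<dots> \<le> E * real r * real r" using y E by (intro mult_left_mono) auto
  also have "\<dots> = 4 * (real CARD('d) + 1)\<^sup>2 * M * (real r / real m)\<^sup>2"
    by (simp add: E_def M1_def d_def power2_eq_square)
  finally show "\<bar>h y - h 0 - (\<Sum>j\<in>UNIV. b j * real_of_int (y$j))\<bar> \<le> 4 * (real CARD('d) + 1)\<^sup>2 * M * (real r / real m)\<^sup>2"
    by (simp add: k_def)
qed

text \<open>Jacobi iteration started at the supersolution \<open>b\<close> decreases and stays above \<open>- b\<close>.\<close>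

lemma discrete_dirichlet:
  fixes f :: "int^'d \<Rightarrow> real"
  assumes f: "\<And>y. znorm y \<le> n \<Longrightarrow> \<bar>f y\<bar> \<le> F" and F: "F \<ge> 0"
  shows "\<exists>v. (\<forall>y. znorm y \<le> n \<longrightarrow> zlap v y = f y) \<and> (\<forall>y. \<bar>v y\<bar> \<le> F * (real n + 1)\<^sup>2)"
proof -
  define d where "d = real CARD('d)"
  have d1: "d \<ge> 1" unfolding d_def by (simp add: Suc_leI)
  \<comment> \<open>The Laplacian of \<open>b\<close> is exactly \<open>- F\<close>. Taking radius n
    + 1 rather than n keeps \<open>b\<close> nonnegative at the neighbours of the ball, so its
    truncation \<open>v0\<close> lies below \<open>b\<close> there.\<close>
  define b where "b y = F * ((real n + 1)\<^sup>2 - zsq y) / (2 * d)" for y :: "int^'d"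
  define v0 where "v0 y = (if znorm y \<le> n then b y else 0)" for y
  define A where "A u y = (\<Sum>j\<in>UNIV. u (y + zunit j) + u (y - zunit j))" for u :: "int^'d \<Rightarrow> real" and y
  define T where "T u y = (if znorm y \<le> n then (A u y - f y) / (2 * d) else 0)" for u y
  define v where "v k = (T ^^ k) v0" for k
  have v_Suc: "v (Suc k) = T (v k)" for k by (simp add: v_def)
  have lapA: "zlap u y = A u y - 2 * d * u y" for u :: "int^'d \<Rightarrow> real" and y
    by (simp add: zlap_def A_def sum_subtractf d_def)
  have Amono: "A u y \<le> A u' y" if "\<And>z. znorm z \<le> Suc (znorm y) \<Longrightarrow> u z \<le> u' z" for u u' y
    unfolding A_def
  proof (intro sum_mono add_mono that)
    fix j show "znorm (y + zunit j) \<le> Suc (znorm y)" "znorm (y - zunit j) \<le> Suc (znorm y)"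
      using znorm_triangle[of y "zunit j"] znorm_triangle_diff[of y "zunit j"] by simp_all
  qed
  have Tmono: "T u y \<le> T u' y" if "\<And>z. u z \<le> u' z" for u u' y
    using Amono[of y u u'] that d1 by (auto simp: T_def divide_right_mono)
  have bnn: "b y \<ge> 0" if "znorm y \<le> Suc n" for y
  proof -
    have "zsq y \<le> (real (znorm y))\<^sup>2" by (rule zsq_le_znorm)
    also have "\<dots> \<le> (real n + 1)\<^sup>2" using that by (intro power_mono) auto
    finally show ?thesis unfolding b_def using F d1 by simp
  qed
  have v0nn: "v0 y \<ge> 0" for y using bnn[of y] by (simp add: v0_def)
  have v0b: "v0 y \<le> b y" if "znorm y \<le> Suc n" for y using bnn[OF that] by (simp add: v0_def)
  have lapb: "A b y = 2 * d * b y - F" for y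
  proof -
    have "b (y + zunit i) + b (y - zunit i) - 2 * b y = - F / d" for i
      using d1 by (simp add: b_def zsq_add zsq_diff field_simps)
    then have "zlap b y = (\<Sum>i\<in>(UNIV::'d set). - F / d)" unfolding zlap_def by (intro sum.cong) auto
    also have "\<dots> = - F" using d1 by (simp add: d_def)
    finally show ?thesis by (simp add: lapA)
  qed
  have T0: "T v0 y \<le> v0 y" for y
  proof (cases "znorm y \<le> n")
    case True
    have "A v0 y \<le> A b y" by (rule Amono) (use True v0b in auto)
    then have "A v0 y - f y \<le> 2 * d * b y" using f[OF True] lapb[of y] by linarith
    then show ?thesis using True d1 by (simp add: T_def v0_def field_simps)
  qed (simp add: T_def v0_def)
  have lo: "- v0 y \<le> T (\<lambda>z. - v0 z) y" for y
  proof (cases "znorm y \<le> n")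
    case True
    have "A (\<lambda>z. - b z) y \<le> A (\<lambda>z. - v0 z) y" by (rule Amono) (use True v0b in auto)
    moreover have "A (\<lambda>z. - b z) y = - A b y" by (simp add: A_def sum_negf[symmetric])
    ultimately have "- (2 * d * b y) \<le> A (\<lambda>z. - v0 z) y - f y" using f[OF True] lapb[of y] by linarith
    then show ?thesis using True d1 by (simp add: T_def v0_def field_simps)
  qed (simp add: T_def v0_def)
  have dec: "v (Suc k) y \<le> v k y" for k y
  proof (induction k arbitrary: y)
    case 0 show ?case using T0 by (simp add: v_def)
  next
    case (Suc k) then show ?case unfolding v_Suc[of "Suc k"] v_Suc[of k] by (intro Tmono) (simp add: v_Suc)
  qed
  have low: "- v0 y \<le> v k y" for k y
  proof (induction k arbitrary: y)
    case 0 show ?case using v0nn[of y] by (simp add: v_def)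
  next
    case (Suc k) show ?case unfolding v_Suc using lo[of y] Tmono[of "\<lambda>z. - v0 z" "v k" y] Suc by force
  qed
  have up: "v k y \<le> v0 y" for k y
  proof (induction k)
    case 0 show ?case by (simp add: v_def)
  next
    case (Suc k) then show ?case using dec[of k y] by linarith
  qed
  have "\<exists>l. (\<lambda>k. v k y) \<longlonglongrightarrow> l" for y
  proof -
    have "Bseq (\<lambda>k. v k y)"
      by (rule BseqI'[where K = "v0 y"]) (use low[of y] up[of _ y] in \<open>auto simp: abs_le_iff minus_le_iff\<close>)
    moreover have "monoseq (\<lambda>k. v k y)" using dec by (intro decseq_imp_monoseq decseq_SucI) auto
    ultimately show ?thesis using Bseq_monoseq_convergent by (auto simp: convergent_def)
  qed
  then obtain V where V: "\<And>y. (\<lambda>k. v k y) \<longlonglongrightarrow> V y" by metis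
  have "zlap V y = f y" if y: "znorm y \<le> n" for y
  proof -
    \<comment> \<open>\<open>T\<close> at a point involves finitely many values only, so the
      pointwise limit of the iterates is a fixed point, that is, a solution.\<close>
    have "(\<lambda>k. T (v k) y) \<longlonglongrightarrow> T V y"
      unfolding T_def A_def using y d1 by (auto intro!: tendsto_intros V)
    moreover have "(\<lambda>k. T (v k) y) \<longlonglongrightarrow> V y"
      using LIMSEQ_Suc[OF V[of y]] by (simp add: v_Suc)
    ultimately have "T V y = V y" by (rule LIMSEQ_unique)
    then have "A V y - f y = 2 * d * V y" using y d1 by (simp add: T_def field_simps)
    then show ?thesis by (simp add: lapA)
  qed
  moreover have "\<bar>V y\<bar> \<le> F * (real n + 1)\<^sup>2" for y
  proof -
    have "V y \<le> v0 y" by (rule LIMSEQ_le_const2[OF V]) (use up in auto)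
    moreover have "- v0 y \<le> V y" by (rule LIMSEQ_le_const[OF V]) (use low in auto)
    moreover have "v0 y \<le> F * (real n + 1)\<^sup>2"
    proof (cases "znorm y \<le> n")
      case True
      have "F * ((real n + 1)\<^sup>2 - zsq y) / (2 * d) \<le> F * ((real n + 1)\<^sup>2 - zsq y) / 1"
        using F d1 bnn[of y] True by (intro divide_left_mono) (auto simp: b_def zero_le_divide_iff)
      also have "\<dots> \<le> F * (real n + 1)\<^sup>2" using F zsq_nonneg[of y] by (simp add: mult_left_mono)
      finally show ?thesis using True by (simp add: v0_def b_def)
    qed (use F in \<open>simp add: v0_def\<close>)
    ultimately show ?thesis by linarith
  qed
  ultimately show ?thesis by blast
qed

text \<open>Subtracting the Dirichlet solution \<open>v\<close> of \<open>zlap v = zlap w\<close>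
  leaves a harmonic function bounded by M + G, where G bounds \<open>v\<close> and is of order F
  m^2. The harmonic part is nearly affine, and \<open>v\<close> itself is put into the
  error.\<close>

lemma poisson_affine_approx:
  fixes w :: "int^'d \<Rightarrow> real"
  assumes m: "m \<ge> 1" and M: "M > 0" and F: "F \<ge> 0"
    and bd: "\<And>y. znorm y \<le> 3 * CARD('d) * m \<Longrightarrow> \<bar>w y\<bar> \<le> M"
    and lap: "\<And>y. znorm y \<le> 3 * CARD('d) * m \<Longrightarrow> \<bar>zlap w y\<bar> \<le> F"
    and r: "r \<le> CARD('d) * m"
  shows "\<exists>a b. \<forall>y. znorm y \<le> r \<longrightarrow>
     \<bar>w y - a - (\<Sum>j\<in>UNIV. b j * real_of_int (y$j))\<bar>
       \<le> 80 * (real CARD('d) + 1)^6 * (M * (real r / real m)\<^sup>2 + F * (real m)\<^sup>2)"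
proof -
  define d where "d = real CARD('d)"
  have d1: "d \<ge> 1" unfolding d_def by (simp add: Suc_leI)
  define G where "G = F * (real (3 * CARD('d) * m) + 1)\<^sup>2"
  define q where "q = (real r / real m)\<^sup>2"
  obtain v where v: "\<And>y. znorm y \<le> 3 * CARD('d) * m \<Longrightarrow> zlap v y = zlap w y" "\<And>y. \<bar>v y\<bar> \<le> G"
    using discrete_dirichlet[of "3 * CARD('d) * m" "zlap w" F] lap F unfolding G_def by blast
  define h where "h y = w y - v y" for y
  have G0: "G \<ge> 0" using F by (simp add: G_def)
  have "\<exists>b. \<forall>r\<le>CARD('d) * m. \<forall>y. znorm y \<le> r \<longrightarrow>
     \<bar>h y - h 0 - (\<Sum>j\<in>UNIV. b j * real_of_int (y$j))\<bar> \<le> 4 * (real CARD('d) + 1)\<^sup>2 * (M + G) * (real r / real m)\<^sup>2"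
  proof (rule harmonic_affine_approx[OF m])
    show "M + G > 0" using M G0 by simp
    fix y :: "int^'d" assume y: "znorm y \<le> 3 * CARD('d) * m"
    show "\<bar>h y\<bar> \<le> M + G" using bd[OF y] v(2)[of y] by (simp add: h_def)
    show "zlap h y = 0" using v(1)[OF y] unfolding h_def by (simp add: zlap_diff)
  qed
  then obtain b where b: "\<And>y. znorm y \<le> r \<Longrightarrow>
     \<bar>h y - h 0 - (\<Sum>j\<in>UNIV. b j * real_of_int (y$j))\<bar> \<le> 4 * (d + 1)\<^sup>2 * (M + G) * q"
    using r unfolding d_def q_def by blast
  have q0: "q \<ge> 0" by (simp add: q_def)
  have q: "q \<le> d\<^sup>2"
  proof -
    have "real r \<le> d * real m" using r unfolding d_def by (metis of_nat_le_iff of_nat_mult)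
    then have "real r / real m \<le> d" using m by (simp add: divide_le_eq)
    then show ?thesis unfolding q_def by (intro power_mono) auto
  qed
  have Gb: "G \<le> 16 * d\<^sup>2 * (F * (real m)\<^sup>2)"
  proof -
    have "real (3 * CARD('d) * m) + 1 \<le> 4 * d * real m"
      using d1 m mult_mono[of 1 d 1 "real m"] by (simp add: d_def mult.commute)
    then have "(real (3 * CARD('d) * m) + 1)\<^sup>2 \<le> (4 * d * real m)\<^sup>2" by (intro power_mono) auto
    then have "G \<le> F * (4 * d * real m)\<^sup>2" unfolding G_def using F by (intro mult_left_mono)
    then show ?thesis by (simp add: power2_eq_square algebra_simps)
  qed
  define X where "X = F * (real m)\<^sup>2"
  have X0: "X \<ge> 0" using F by (simp add: X_def)
  \<comment> \<open>With p = (d + 1)^2 one has G \<le> 16 p X and q \<le> p, so the terms with G sum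
    to at most 64 p^3 X + 16 p X; this is the origin of 80 = 64 + 16 and of the sixth power.\<close>
  have key: "4 * (d + 1)\<^sup>2 * (M + G) * q + G \<le> 80 * (d + 1)^6 * (M * q + X)"
  proof -
    have e1: "4 * (d + 1)\<^sup>2 \<le> 80 * (d + 1)^6"
    proof -
      have "(d+1)^2 \<le> (d+1)^6" using d1 by (intro power_increasing) auto
      moreover have "(d+1)^2 \<ge> 0" by simp
      ultimately show ?thesis by linarith
    qed
    have "4 * (d + 1)\<^sup>2 * (M * q) \<le> 80 * (d + 1)^6 * (M * q)"
      using e1 M q0 by (intro mult_right_mono) auto
    moreover have "4 * (d + 1)\<^sup>2 * (G * q) + G \<le> 80 * (d + 1)^6 * X"
    proof -
      define p where "p = (d + 1)\<^sup>2"
      have p: "p \<ge> 1" "d\<^sup>2 \<le> p" using d1 by (auto simp: p_def one_le_power power_mono)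
      have Gp: "G \<le> 16 * p * X"
        using Gb p X0 mult_right_mono[of "d\<^sup>2" p X] unfolding X_def by linarith
      have "G * q \<le> (16 * p * X) * p" using Gp q p q0 X0 G0 by (intro mult_mono) auto
      then have "4 * p * (G * q) \<le> 4 * p * ((16 * p * X) * p)" using p by (intro mult_left_mono) auto
      moreover have "p * X \<le> p * p * p * X"
        using p X0 mult_mono[of 1 p 1 p] by (intro mult_right_mono) auto
      moreover have "(d+1)^6 = p * p * p" by (simp add: p_def eval_nat_numeral)
      ultimately show ?thesis using Gp unfolding p_def[symmetric] by (simp add: algebra_simps)
    qed
    ultimately show ?thesis by (simp add: algebra_simps)
  qed
  show ?thesis
  proof (intro exI[of _ "h 0"] exI[of _ b] allI impI)
    fix y :: "int^'d" assume y: "znorm y \<le> r"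
    have "\<bar>w y - h 0 - (\<Sum>j\<in>UNIV. b j * real_of_int (y$j))\<bar> \<le> 4 * (d + 1)\<^sup>2 * (M + G) * q + G"
      using b[OF y] v(2)[of y] unfolding h_def by linarith
    then show "\<bar>w y - h 0 - (\<Sum>j\<in>UNIV. b j * real_of_int (y$j))\<bar>
       \<le> 80 * (real CARD('d) + 1)^6 * (M * (real r / real m)\<^sup>2 + F * (real m)\<^sup>2)"
      using key unfolding d_def q_def X_def by linarith
  qed
qed

section \<open>Germs on the integer lattice\<close>

abbreviation zball :: "nat \<Rightarrow> (int^'d) set" where
  "zball n \<equiv> {z. znorm z \<le> n}"

text \<open>Since \<open>u 0 = 0\<close>, the constants \<open>a k\<close> are as small as the
  error. Comparing the approximations at scales 2^k and 2^(k+1) at the point 2^k e_j shows that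
  slopes change by at most a multiple of A 2^(k (\<eta> - 1)). As \<eta> > 1, this geometric sum is
  dominated by its last term; it starts at scale 1, where \<open>u (zunit j) = 0\<close> bounds the
  slope.\<close>

lemma growth_from_affine_approx:
  fixes u :: "int^'d \<Rightarrow> real"
  assumes \<eta>: "1 < \<eta>" and A: "0 \<le> A" and u0: "u 0 = 0" "\<And>j. u (zunit j) = 0"
    and approx: "\<And>k. \<exists>a b. \<forall>y. znorm y \<le> 2^k \<longrightarrow>
        \<bar>u y - a - (\<Sum>j\<in>UNIV. b j * real_of_int (y$j))\<bar> \<le> A * (2^k) powr \<eta>"
  shows "\<bar>u y\<bar> \<le> (4 + 2 * (1 + 2 powr \<eta>) / (2 powr (\<eta> - 1) - 1)) * 2 powr \<eta> * A * real (znorm y) powr \<eta>"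
proof (cases "y = 0")
  case False
  define p q where "p = 2 powr \<eta>" and "q = 2 powr (\<eta> - 1)"
  \<comment> \<open>\<open>D\<close> is chosen for the induction on slopes: D \<ge> 2 covers scale
    1, and D (q - 1) \<ge> 2 (1 + p) lets the increment fit between D A q^k and D A q^(k+1).\<close>
  define D where "D = 2 + 2 * (1 + p) / (q - 1)"
  have q1: "q > 1" unfolding q_def using \<eta> powr_less_mono[of 0 "\<eta> - 1" 2] by simp
  have p2q: "p = 2 * q" unfolding p_def q_def by (simp add: powr_diff)
  have p0: "p > 0" by (simp add: p_def)
  have D0: "D \<ge> 2" unfolding D_def using q1 p0 by simp
  have pk: "(2^k) powr \<eta> = p ^ k" for k :: nat
    by (simp add: p_def powr_realpow[symmetric] powr_powr mult.commute)
  from approx obtain a b where ab: "\<And>k y. znorm y \<le> 2^k \<Longrightarrow>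
      \<bar>u y - a k - (\<Sum>j\<in>UNIV. b k j * real_of_int (y$j))\<bar> \<le> A * p ^ k"
    unfolding pk by metis
  have lin: "(\<Sum>i\<in>UNIV. c i * real_of_int ((int n *s zunit j)$i)) = c j * real n" for c n j
  proof -
    have "(\<Sum>i\<in>UNIV. c i * real_of_int ((int n *s zunit j)$i)) = (\<Sum>i\<in>UNIV. if i = j then c i * real n else 0)"
      by (intro sum.cong) (auto simp: zunit_nth)
    then show ?thesis by simp
  qed
  have nrm: "znorm (int n *s zunit j :: int^'d) = n" for n j
  proof -
    have "znorm (int n *s zunit j :: int^'d) = (\<Sum>i\<in>UNIV. if i = j then n else 0)"
      unfolding znorm_def by (intro sum.cong) (auto simp: zunit_nth)
    then show ?thesis by simp
  qed
  have a0: "\<bar>a k\<bar> \<le> A * p ^ k" for k using ab[of 0 k] u0(1) by simp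
  have at: "\<bar>u (int n *s zunit j) - a k - b k j * real n\<bar> \<le> A * p ^ k" if "n \<le> 2^k" for n k j
    using ab[of "int n *s zunit j" k] that unfolding nrm lin by simp
  have b: "\<bar>b k j\<bar> \<le> D * A * q ^ k" for k j
  proof (induction k)
    case 0
    have "\<bar>b 0 j\<bar> \<le> 2 * A" using at[of 1 0 j] a0[of 0] u0 by (auto simp: abs_le_iff)
    also have "\<dots> \<le> D * A" using D0 A by (intro mult_right_mono) auto
    finally show ?case by simp
  next
    case (Suc k)
    have "\<bar>(b (Suc k) j - b k j) * 2 ^ k\<bar> \<le> 2 * (A * p ^ k) + 2 * (A * p ^ Suc k)"
      using at[of "2^k" k j] at[of "2^k" "Suc k" j] a0[of k] a0[of "Suc k"]
      by (simp add: left_diff_distrib)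
    also have "\<dots> = (2 * (1 + p) * A * q ^ k) * 2 ^ k"
      by (simp add: p2q power_mult_distrib algebra_simps)
    finally have "\<bar>b (Suc k) j - b k j\<bar> * 2 ^ k \<le> (2 * (1 + p) * A * q ^ k) * 2 ^ k" by (simp add: abs_mult)
    then have "\<bar>b (Suc k) j - b k j\<bar> \<le> 2 * (1 + p) * A * q ^ k" by (rule mult_right_le_imp_le) simp
    also have "\<dots> \<le> D * (q - 1) * A * q ^ k"
    proof -
      have "D * (q - 1) = 2 * (q - 1) + 2 * (1 + p)" unfolding D_def using q1 by (simp add: field_simps)
      then have "2 * (1 + p) \<le> D * (q - 1)" using q1 by simp
      then show ?thesis using A q1 by (intro mult_right_mono) auto
    qed
    finally have "\<bar>b (Suc k) j\<bar> \<le> D * (q - 1) * A * q ^ k + D * A * q ^ k" using Suc by linarith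
    then show ?case by (simp add: algebra_simps)
  qed
  define n where "n = znorm y"
  have n1: "n \<ge> 1" using False znorm_eq_0_iff[of y] unfolding n_def by linarith
  obtain k' where k': "2 ^ k' \<le> n" "n < 2 ^ Suc k'"
    using ex_power_ivl1[of 2 n] n1 by auto
  define k where "k = Suc k'"
  have k: "znorm y \<le> 2 ^ k" "(2 ^ k :: real) \<le> 2 * real n"
    using k' by (auto simp: k_def n_def)
  have "\<bar>\<Sum>j\<in>UNIV. b k j * real_of_int (y$j)\<bar> \<le> (\<Sum>j\<in>UNIV. D * A * q ^ k * \<bar>real_of_int (y$j)\<bar>)"
    by (rule order_trans[OF sum_abs]) (intro sum_mono, simp add: abs_mult b mult_right_mono)
  also have "\<dots> = D * A * q ^ k * real (znorm y)" by (simp add: sum_distrib_left real_znorm)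
  also have "\<dots> \<le> D * A * q ^ k * 2 ^ k"
    using k(1) D0 A q1 by (intro mult_left_mono) (auto simp flip: of_nat_le_iff)
  also have "\<dots> = D * A * p ^ k" by (simp add: p2q power_mult_distrib)
  finally have "\<bar>u y\<bar> \<le> A * p ^ k + A * p ^ k + D * A * p ^ k"
    using ab[OF k(1)] a0[of k] by linarith
  also have "\<dots> = (2 + D) * A * p ^ k" by (simp add: algebra_simps)
  also have "\<dots> \<le> (2 + D) * A * (p * real n powr \<eta>)"
  proof -
    have "p ^ k \<le> (2 * real n) powr \<eta>"
      unfolding pk[symmetric] using k(2) \<eta> by (intro powr_mono2) auto
    also have "\<dots> = p * real n powr \<eta>" by (simp add: p_def powr_mult)
    finally show ?thesis using D0 A by (intro mult_left_mono) auto
  qed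
  finally show ?thesis unfolding D_def p_def q_def n_def by (simp add: mult_ac)
qed (use u0 in simp)

section \<open>Mollification with symmetric lattice kernels\<close>

lemma sum_shift:
  fixes \<kappa> f :: "int^'d \<Rightarrow> real"
  assumes supp: "\<And>z. znorm z > n \<Longrightarrow> \<kappa> z = 0" and e: "znorm e \<le> 1"
  shows "(\<Sum>z\<in>zball n. \<kappa> z * f (z + e)) = (\<Sum>z\<in>zball (Suc n). \<kappa> (z - e) * f z)"
proof -
  have "(\<Sum>z\<in>zball n. \<kappa> z * f (z + e)) = (\<Sum>z\<in>(\<lambda>z. z + e) ` zball n. \<kappa> (z - e) * f z)"
    by (subst sum.reindex) (auto simp: inj_on_def)
  also have "\<dots> = (\<Sum>z\<in>zball (Suc n). \<kappa> (z - e) * f z)"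
  proof (rule sum.mono_neutral_left[OF finite_zball])
    show "(\<lambda>z. z + e) ` zball n \<subseteq> zball (Suc n)"
    proof safe
      fix z :: "int^'d" assume "znorm z \<le> n"
      then show "znorm (z + e) \<le> Suc n" using znorm_triangle[of z e] e by linarith
    qed
    show "\<forall>z\<in>zball (Suc n) - (\<lambda>z. z + e) ` zball n. \<kappa> (z - e) * f z = 0"
    proof
      fix z assume "z \<in> zball (Suc n) - (\<lambda>z. z + e) ` zball n"
      then have "z - e \<notin> zball n" by (metis DiffD2 diff_add_cancel imageI)
      then show "\<kappa> (z - e) * f z = 0" using supp[of "z - e"] by simp
    qed
  qed
  finally show ?thesis .
qed

text \<open>Each shift of the summation variable moves the difference onto the kernel; the ball
  grows by one because \<open>zlap \<kappa>\<close> also lives on the neighbours of the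
  support.\<close>

lemma sum_zlap_by_parts:
  fixes \<kappa> f :: "int^'d \<Rightarrow> real"
  assumes supp: "\<And>z. znorm z > n \<Longrightarrow> \<kappa> z = 0"
  shows "(\<Sum>z\<in>zball n. \<kappa> z * zlap f z) = (\<Sum>z\<in>zball (Suc n). zlap \<kappa> z * f z)"
proof -
  have s: "(\<Sum>z\<in>zball n. \<kappa> z * f (z + e)) = (\<Sum>z\<in>zball (Suc n). \<kappa> (z - e) * f z)" if "znorm e \<le> 1" for e
    by (rule sum_shift) (use supp that in auto)
  have "(\<Sum>z\<in>zball n. \<kappa> z * zlap f z) = (\<Sum>j\<in>UNIV. (\<Sum>z\<in>zball n. \<kappa> z * f (z + zunit j))
      + (\<Sum>z\<in>zball n. \<kappa> z * f (z + (- zunit j))) - 2 * (\<Sum>z\<in>zball n. \<kappa> z * f (z + 0)))"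
    unfolding zlap_def sum_distrib_left
    by (subst sum.swap) (simp add: algebra_simps sum.distrib sum_subtractf sum_distrib_left)
  also have "\<dots> = (\<Sum>j\<in>UNIV. (\<Sum>z\<in>zball (Suc n). \<kappa> (z - zunit j) * f z)
      + (\<Sum>z\<in>zball (Suc n). \<kappa> (z - (- zunit j)) * f z) - 2 * (\<Sum>z\<in>zball (Suc n). \<kappa> (z - 0) * f z))"
    by (subst (1 2 3) s) simp_all
  also have "\<dots> = (\<Sum>j\<in>UNIV. \<Sum>z\<in>zball (Suc n). (\<kappa> (z + zunit j) + \<kappa> (z - zunit j) - 2 * \<kappa> z) * f z)"
    by (simp add: algebra_simps sum.distrib sum_subtractf sum_distrib_left)
  also have "\<dots> = (\<Sum>z\<in>zball (Suc n). zlap \<kappa> z * f z)"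
    unfolding zlap_def sum_distrib_right by (rule sum.swap)
  finally show ?thesis .
qed

text \<open>Symmetry and unit mass make averaging preserve affine functions. The last condition
  replaces smoothness: it is the summed cost of moving a Laplacian onto the kernel. The kernel
  vanishes already at distance exactly s, so for s = 1 only the origin is charged.\<close>

definition smoothing_kernel :: "real \<Rightarrow> real \<Rightarrow> (int^'d \<Rightarrow> real) \<Rightarrow> bool" where
  "smoothing_kernel c s \<kappa> \<longleftrightarrow> (\<forall>z. 0 \<le> \<kappa> z) \<and> (\<forall>z. s \<le> real (znorm z) \<longrightarrow> \<kappa> z = 0) \<and>
     (\<forall>z. \<kappa> (- z) = \<kappa> z) \<and> (\<Sum>z\<in>zball (nat \<lceil>s\<rceil>). \<kappa> z) = 1 \<and>
     (\<Sum>z\<in>zball (Suc (nat \<lceil>s\<rceil>)). \<bar>zlap \<kappa> z\<bar>) \<le> c / s\<^sup>2"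

definition mollify :: "real \<Rightarrow> (int^'d \<Rightarrow> real) \<Rightarrow> (int^'d \<Rightarrow> real) \<Rightarrow> int^'d \<Rightarrow> real" where
  "mollify s \<kappa> u y = (\<Sum>z\<in>zball (nat \<lceil>s\<rceil>). \<kappa> z * u (y + z))"

lemma abs_sum_kernel_le:
  assumes \<kappa>: "smoothing_kernel c s \<kappa>"
    and f: "\<And>z. real (znorm z) < s \<Longrightarrow> \<bar>f z\<bar> \<le> B"
  shows "\<bar>\<Sum>z\<in>zball (nat \<lceil>s\<rceil>). \<kappa> z * f z\<bar> \<le> B"
proof -
  have "\<bar>\<Sum>z\<in>zball (nat \<lceil>s\<rceil>). \<kappa> z * f z\<bar> \<le> (\<Sum>z\<in>zball (nat \<lceil>s\<rceil>). \<kappa> z * B)"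
  proof (rule order_trans[OF sum_abs], rule sum_mono)
    fix z
    have "0 \<le> \<kappa> z" "real (znorm z) \<ge> s \<longrightarrow> \<kappa> z = 0" using \<kappa> by (auto simp: smoothing_kernel_def)
    then show "\<bar>\<kappa> z * f z\<bar> \<le> \<kappa> z * B"
      using f[of z] by (cases "real (znorm z) < s") (auto simp: abs_mult mult_left_mono)
  qed
  also have "\<dots> = B" using \<kappa> by (simp add: smoothing_kernel_def flip: sum_distrib_right)
  finally show ?thesis .
qed

text \<open>Needed when \<delta> R \<le> 1: then s = 1, and the general error N s^\<eta> need not be
  bounded by N \<delta>^\<eta> R^\<eta>; instead there is no mollification error at all.\<close>

lemma mollify_unit_scale:
  assumes \<kappa>: "smoothing_kernel c s \<kappa>" and s: "s = 1"
  shows "mollify s \<kappa> u y = u y"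
proof -
  have z: "\<kappa> z = 0" if "z \<noteq> 0" for z
    using \<kappa> that s by (auto simp: smoothing_kernel_def Suc_le_eq)
  have "(\<Sum>z\<in>zball (nat \<lceil>s\<rceil>). \<kappa> z * g z) = (\<Sum>z\<in>{0}. \<kappa> z * g z)" for g
    by (rule sum.mono_neutral_right[OF finite_zball]) (auto simp: z)
  from this[of "\<lambda>_. 1"] this[of "\<lambda>z. u (y + z)"] show ?thesis
    using \<kappa> by (simp add: mollify_def smoothing_kernel_def)
qed

text \<open>The symmetric kernel pairs z with -z, and the midpoint identity evaluates each pair to
  twice the central value.\<close>

lemma mollify_affine:
  assumes \<kappa>: "smoothing_kernel c s \<kappa>" and P: "\<And>z. P (y + z) + P (y - z) = 2 * P y"
  shows "mollify s \<kappa> P y = P y"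
proof -
  let ?B = "zball (nat \<lceil>s\<rceil>)"
  have "mollify s \<kappa> P y = (\<Sum>z\<in>?B. \<kappa> (- z) * P (y + - z))"
    unfolding mollify_def by (rule sum.reindex_bij_witness[of _ uminus uminus]) auto
  also have "\<dots> = (\<Sum>z\<in>?B. \<kappa> z * P (y - z))" using \<kappa> by (simp add: smoothing_kernel_def)
  finally have "2 * mollify s \<kappa> P y = (\<Sum>z\<in>?B. \<kappa> z * (P (y + z) + P (y - z)))"
    by (simp add: mollify_def algebra_simps sum.distrib)
  also have "\<dots> = 2 * P y" unfolding P using \<kappa> by (simp add: smoothing_kernel_def flip: sum_distrib_right)
  finally show ?thesis by simp
qed

lemma zlap_mollify: "zlap (mollify s \<kappa> u) y = mollify s \<kappa> (zlap u) y"
  unfolding mollify_def zlap_def sum_distrib_left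
  by (subst sum.swap) (simp add: algebra_simps sum.distrib sum_subtractf sum_distrib_left)

text \<open>Write u = V + P + q, with V the germ based at y and q the Hoelder remainder. The
  averaged Laplacian of V at y is what \<open>lap\<close> controls, P is harmonic and unchanged by
  averaging, and for q the Laplacian is moved onto the kernel. \<open>T\<close> stands for the
  distance between the base points of u and V.\<close>

lemma mollify_germ_bounds:
  fixes u V P :: "int^'d \<Rightarrow> real"
  assumes \<kappa>: "smoothing_kernel c s \<kappa>" and s: "s \<ge> 1" and ex: "0 < \<alpha>" "\<alpha> < \<eta>" and N: "0 \<le> N" and H: "0 \<le> H"
    and Vy: "V y = 0" and V: "\<And>z. \<bar>V z\<bar> \<le> N * real (znorm (y - z)) powr \<eta>"
    and P: "\<And>a z. P (a + z) + P (a - z) = 2 * P a"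
    and hol: "\<And>z. \<bar>u z - V z - P z\<bar> \<le> H * real (znorm (y - z)) powr \<alpha> * (T + real (znorm (y - z))) powr (\<eta> - \<alpha>)"
    and lap: "\<bar>mollify s \<kappa> (zlap V) y\<bar> \<le> K * s powr (\<eta> - 2)" and T: "0 \<le> T"
  shows "\<bar>mollify s \<kappa> u y - u y\<bar> \<le> N * s powr \<eta> + H * s powr \<alpha> * (T + s) powr (\<eta> - \<alpha>)"
    and "\<bar>zlap (mollify s \<kappa> u) y\<bar> \<le> K * s powr (\<eta> - 2) + c / s\<^sup>2 * (H * (3 * s) powr \<alpha> * (T + 3 * s) powr (\<eta> - \<alpha>))"
proof -
  define q where "q z = u z - V z - P z" for z
  \<comment> \<open>At z = y the Hoelder bound contains \<open>0 powr \<alpha> = 0\<close>, so the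
    remainder vanishes exactly; averaging errors can therefore be measured against P.\<close>
  have Py: "P y = u y" using hol[of y] Vy by simp
  have \<kappa>0: "\<kappa> z = 0" if "znorm z > nat \<lceil>s\<rceil>" for z
  proof -
    have "s \<le> real (znorm z)" using that by linarith
    then show ?thesis using \<kappa> by (auto simp: smoothing_kernel_def)
  qed
  have qb: "\<bar>q (y + z)\<bar> \<le> H * t powr \<alpha> * (T + t) powr (\<eta> - \<alpha>)" if "real (znorm z) \<le> t" for z t
  proof -
    have "\<bar>q (y + z)\<bar> \<le> H * real (znorm z) powr \<alpha> * (T + real (znorm z)) powr (\<eta> - \<alpha>)"
      using hol[of "y + z"] by (simp add: q_def)
    also have "\<dots> \<le> H * t powr \<alpha> * (T + t) powr (\<eta> - \<alpha>)"
      using that H T ex by (intro mult_mono powr_mono2) auto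
    finally show ?thesis .
  qed
  have "mollify s \<kappa> u y - u y = mollify s \<kappa> u y - mollify s \<kappa> P y"
    using mollify_affine[OF \<kappa> P] Py by simp
  also have "\<dots> = (\<Sum>z\<in>zball (nat \<lceil>s\<rceil>). \<kappa> z * (V (y + z) + q (y + z)))"
    by (simp add: mollify_def q_def algebra_simps sum_subtractf)
  also have "\<bar>\<dots>\<bar> \<le> N * s powr \<eta> + H * s powr \<alpha> * (T + s) powr (\<eta> - \<alpha>)"
  proof (rule abs_sum_kernel_le[OF \<kappa>])
    fix z :: "int^'d" assume z: "real (znorm z) < s"
    have "\<bar>V (y + z)\<bar> \<le> N * real (znorm z) powr \<eta>" using V[of "y + z"] by simp
    also have "\<dots> \<le> N * s powr \<eta>" using z N ex by (intro mult_left_mono powr_mono2) auto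
    finally show "\<bar>V (y + z) + q (y + z)\<bar> \<le> N * s powr \<eta> + H * s powr \<alpha> * (T + s) powr (\<eta> - \<alpha>)"
      using qb[of z s] z by linarith
  qed
  finally show "\<bar>mollify s \<kappa> u y - u y\<bar> \<le> N * s powr \<eta> + H * s powr \<alpha> * (T + s) powr (\<eta> - \<alpha>)" .
  have lP: "zlap P z = 0" for z unfolding zlap_def using P by simp
  have "zlap u z = zlap V z + zlap q z" for z
    using zlap_diff[of "\<lambda>z. u z - V z" P z] zlap_diff[of u V z] by (simp add: q_def[abs_def] lP)
  then have "zlap (mollify s \<kappa> u) y = mollify s \<kappa> (zlap V) y + mollify s \<kappa> (zlap q) y"
    unfolding zlap_mollify by (simp add: mollify_def algebra_simps sum.distrib)
  moreover have "\<bar>mollify s \<kappa> (zlap q) y\<bar> \<le> c / s\<^sup>2 * (H * (3 * s) powr \<alpha> * (T + 3 * s) powr (\<eta> - \<alpha>))"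
  proof -
    define X where "X = H * (3 * s) powr \<alpha> * (T + 3 * s) powr (\<eta> - \<alpha>)"
    have X: "X \<ge> 0" using H by (simp add: X_def)
    have "mollify s \<kappa> (zlap q) y = (\<Sum>z\<in>zball (nat \<lceil>s\<rceil>). \<kappa> z * zlap (\<lambda>z. q (y + z)) z)"
      by (simp add: mollify_def zlap_shift)
    also have "\<dots> = (\<Sum>z\<in>zball (Suc (nat \<lceil>s\<rceil>)). zlap \<kappa> z * q (y + z))"
      by (rule sum_zlap_by_parts[OF \<kappa>0])
    also have "\<bar>\<dots>\<bar> \<le> (\<Sum>z\<in>zball (Suc (nat \<lceil>s\<rceil>)). \<bar>zlap \<kappa> z\<bar> * X)"
    proof (rule order_trans[OF sum_abs], rule sum_mono)
      fix z :: "int^'d" assume "z \<in> zball (Suc (nat \<lceil>s\<rceil>))"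
      \<comment> \<open>The enlarged ball has radius at most s + 2, which is at most 3 s because s
        \<ge> 1.\<close>
      then have "real (znorm z) \<le> 3 * s" using s by simp linarith
      then have "\<bar>q (y + z)\<bar> \<le> X" unfolding X_def by (rule qb)
      then show "\<bar>zlap \<kappa> z * q (y + z)\<bar> \<le> \<bar>zlap \<kappa> z\<bar> * X" by (simp add: abs_mult mult_left_mono)
    qed
    also have "\<dots> \<le> c / s\<^sup>2 * X" unfolding sum_distrib_right[symmetric]
      using \<kappa> X by (intro mult_right_mono) (auto simp: smoothing_kernel_def)
    finally show ?thesis by (simp add: X_def)
  qed
  ultimately show "\<bar>zlap (mollify s \<kappa> u) y\<bar> \<le> K * s powr (\<eta> - 2) + c / s\<^sup>2 * (H * (3 * s) powr \<alpha> * (T + 3 * s) powr (\<eta> - \<alpha>))"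
    using lap by linarith
qed


text \<open>Of the affine polynomial in the Hoelder seminorm only the midpoint identity is used: it makes the
  polynomial harmonic and invariant under mollification with a symmetric kernel.\<close>

locale zgerm =
  fixes U :: "int^'d \<Rightarrow> int^'d \<Rightarrow> real" and \<kappa> :: "real \<Rightarrow> int^'d \<Rightarrow> real" and \<alpha> \<eta> N H K c :: real
  assumes ex: "0 < \<alpha>" "\<alpha> < 1" "1 < \<eta>" "\<eta> < 2"
    and N: "0 < N" and H: "0 \<le> H" and K: "0 \<le> K" and c: "0 \<le> c"
    and kernel: "\<And>s. s \<ge> 1 \<Longrightarrow> smoothing_kernel c s (\<kappa> s)"
    and center: "\<And>x. U x x = 0" "\<And>x j. U x (x + zunit j) = 0"
    and growth: "\<And>x y. \<bar>U x y\<bar> \<le> N * real (znorm (x - y)) powr \<eta>"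
    and hoelder: "\<And>x y. \<exists>P. (\<forall>a z. P (a + z) + P (a - z) = 2 * P a) \<and>
       (\<forall>z. \<bar>U x z - U y z - P z\<bar>
          \<le> H * real (znorm (y - z)) powr \<alpha> * (real (znorm (x - y)) + real (znorm (y - z))) powr (\<eta> - \<alpha>))"
    and laplace: "\<And>x s. s \<ge> 1 \<Longrightarrow> \<bar>mollify s (\<kappa> s) (zlap (U x)) x\<bar> \<le> K * s powr (\<eta> - 2)"
begin

text \<open>\<open>poisson_affine_approx\<close> is applied to the mollified function with m = L r.
  The growth bound supplies M of order N (L R)^\<eta>, and the factor (r / m)^2 = L^(-2) turns it
  into N L^(\<eta> - 2) R^\<eta>; the Laplacian bound F1 (K + H) R^(\<eta> - 2) is multiplied by
  m^2. The term N \<delta>^\<eta> comes from undoing the mollification. \<open>F1\<close> blows up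
  as \<delta> tends to 0, but it multiplies only K + H.\<close>

lemma affine_approx_scale:
  fixes r L :: nat
  assumes r: "1 \<le> r" and L: "1 \<le> L" and \<delta>: "0 < \<delta>" "\<delta> \<le> 1"
  defines "d \<equiv> real CARD('d)"
  defines "F1 \<equiv> \<delta> powr (\<eta> - 2) + 3 * c * \<delta> powr (\<alpha> - 2) * (6 * d * real L) powr (\<eta> - \<alpha>)"
  shows "\<exists>a b. \<forall>y. znorm y \<le> r \<longrightarrow> \<bar>U x (x + y) - a - (\<Sum>j\<in>UNIV. b j * real_of_int (y$j))\<bar>
     \<le> (N * (80 * (d + 1)^6 * (6 * d) powr \<eta> * real L powr (\<eta> - 2) + \<delta> powr \<eta>)
        + (80 * (d + 1)^6 * F1 * (real L)\<^sup>2 + 4) * (K + H)) * real r powr \<eta>"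
proof -
  define R l where "R = real r" and "l = real L"
  have R1: "R \<ge> 1" and l1: "l \<ge> 1" using r L by (auto simp: R_def l_def)
  have d1: "d \<ge> 1" unfolding d_def by (simp add: Suc_leI)
  define s where "s = max (\<delta> * R) 1"
  have s: "s \<ge> 1" "s \<le> R" "\<delta> * R \<le> s" using \<delta> R1 by (auto simp: s_def mult_left_le_one_le)
  define m where "m = L * r"
  have m1: "m \<ge> 1" unfolding m_def using r L by simp
  have m: "real m = l * R" by (simp add: m_def l_def R_def)
  \<comment> \<open>\<open>T\<close> is the radius on which \<open>poisson_affine_approx\<close>
    needs its bounds; 6 d l R also leaves room for the width 3 s of the kernel and its
    Laplacian.\<close>
  define T where "T = 3 * d * l * R"
  have "1 * 1 \<le> d * l" using d1 l1 by (intro mult_mono) auto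
  then have "1 * R \<le> (d * l) * R" using R1 by (intro mult_right_mono) auto
  moreover have "T = 3 * (d * l * R)" "6 * d * l * R = 6 * (d * l * R)" by (simp_all add: T_def)
  ultimately have T: "T + 3 * s \<le> 6 * d * l * R" "R \<le> T" using s R1 by linarith+
  have T0: "T \<ge> 0" using T(2) R1 by linarith
  have Tm: "real (3 * CARD('d) * m) = T" by (simp add: T_def m d_def)
  note \<kappa> = kernel[OF s(1)]
  define u where "u z = U x (x + z)" for z
  define w where "w = mollify s (\<kappa> s) u"
  have bds: "\<bar>w y - u y\<bar> \<le> N * s powr \<eta> + H * s powr \<alpha> * (real (znorm y) + s) powr (\<eta> - \<alpha>)"
    "\<bar>zlap w y\<bar> \<le> K * s powr (\<eta> - 2) + c / s\<^sup>2 * (H * (3 * s) powr \<alpha> * (real (znorm y) + 3 * s) powr (\<eta> - \<alpha>))" for y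
  proof -
    obtain P where P: "\<And>a z. P (a + z) + P (a - z) = 2 * P a"
      "\<And>z. \<bar>U x z - U (x + y) z - P z\<bar>
          \<le> H * real (znorm (x + y - z)) powr \<alpha> * (real (znorm (x - (x + y))) + real (znorm (x + y - z))) powr (\<eta> - \<alpha>)"
      using hoelder[of x "x + y"] by blast
    define V where "V z = U (x + y) (x + z)" for z
    have e: "mollify s (\<kappa> s) (zlap V) y = mollify s (\<kappa> s) (zlap (U (x + y))) (x + y)"
      unfolding mollify_def V_def zlap_shift by (simp add: add.assoc)
    have P': "P (x + (a + z)) + P (x + (a - z)) = 2 * P (x + a)" for a z
      using P(1)[of "x + a" z] by (simp add: algebra_simps)
    have hol: "\<bar>u z - V z - P (x + z)\<bar>
          \<le> H * real (znorm (y - z)) powr \<alpha> * (real (znorm y) + real (znorm (y - z))) powr (\<eta> - \<alpha>)" for z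
      using P(2)[of "x + z"] by (simp add: u_def V_def)
    have lap: "\<bar>mollify s (\<kappa> s) (zlap V) y\<bar> \<le> K * s powr (\<eta> - 2)"
      unfolding e by (rule laplace[OF s(1)])
    have Vb: "\<bar>V z\<bar> \<le> N * real (znorm (y - z)) powr \<eta>" for z
      using growth[of "x + y" "x + z"] by (simp add: V_def)
    show "\<bar>w y - u y\<bar> \<le> N * s powr \<eta> + H * s powr \<alpha> * (real (znorm y) + s) powr (\<eta> - \<alpha>)"
      "\<bar>zlap w y\<bar> \<le> K * s powr (\<eta> - 2) + c / s\<^sup>2 * (H * (3 * s) powr \<alpha> * (real (znorm y) + 3 * s) powr (\<eta> - \<alpha>))"
      unfolding w_def
      by (rule mollify_germ_bounds[OF \<kappa> s(1) ex(1) _ _ H _ Vb P' hol lap]; use ex N center in \<open>simp add: V_def\<close>)+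
  qed
  define M where "M = N * (6 * d * l * R) powr \<eta>"
  define F where "F = F1 * (K + H) * R powr (\<eta> - 2)"
  have F10: "F1 \<ge> 0" using c by (simp add: F1_def)
  have wM: "\<bar>w y\<bar> \<le> M" if y: "znorm y \<le> 3 * CARD('d) * m" for y
    unfolding w_def mollify_def
  proof (rule abs_sum_kernel_le[OF \<kappa>])
    fix z :: "int^'d" assume z: "real (znorm z) < s"
    have yT: "real (znorm y) \<le> T" using y unfolding Tm[symmetric] by (simp only: of_nat_le_iff)
    have "real (znorm (y + z)) \<le> 6 * d * l * R"
      using znorm_triangle[of y z] yT z T s by linarith
    then have "N * real (znorm (y + z)) powr \<eta> \<le> M"
      unfolding M_def using N ex by (intro mult_left_mono powr_mono2) auto
    moreover have "x - (x + (y + z)) = - (y + z)" by simp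
    then have "znorm (x - (x + (y + z))) = znorm (y + z)" by (simp only: znorm_minus)
    ultimately show "\<bar>u (y + z)\<bar> \<le> M"
      using growth[of x "x + (y + z)"] by (simp add: u_def)
  qed
  have wF: "\<bar>zlap w y\<bar> \<le> F" if y: "znorm y \<le> 3 * CARD('d) * m" for y
  proof -
    have yT: "real (znorm y) \<le> T" using y unfolding Tm[symmetric] by (simp only: of_nat_le_iff)
    \<comment> \<open>Negative powers of s reverse the inequality s \<ge> \<delta> R; this is where
      the negative powers of \<delta> in \<open>F1\<close> arise.\<close>
    have sp: "s powr e \<le> \<delta> powr e * R powr e" if "e \<le> 0" for e
    proof -
      have "s powr e \<le> (\<delta> * R) powr e" using that s \<delta> R1 by (intro powr_mono2') auto
      then show ?thesis using \<delta> R1 by (simp add: powr_mult)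
    qed
    have "c / s\<^sup>2 * (H * (3 * s) powr \<alpha> * (real (znorm y) + 3 * s) powr (\<eta> - \<alpha>))
        = c * H * 3 powr \<alpha> * s powr (\<alpha> - 2) * (real (znorm y) + 3 * s) powr (\<eta> - \<alpha>)"
      using s by (simp add: powr_diff powr_mult)
    also have "\<dots> \<le> c * H * 3 * (\<delta> powr (\<alpha> - 2) * R powr (\<alpha> - 2)) * (6 * d * l * R) powr (\<eta> - \<alpha>)"
    proof (intro mult_mono sp powr_mono2)
      show "3 powr \<alpha> \<le> (3::real)" using powr_mono[of \<alpha> 1 3] ex by simp
    qed (use c H ex s yT T in \<open>auto intro!: mult_nonneg_nonneg\<close>)
    also have "\<dots> = (3 * c * \<delta> powr (\<alpha> - 2) * (6 * d * l) powr (\<eta> - \<alpha>)) * H * (R powr (\<alpha> - 2) * R powr (\<eta> - \<alpha>))"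
      using d1 l1 R1 by (simp add: powr_mult)
    also have "R powr (\<alpha> - 2) * R powr (\<eta> - \<alpha>) = R powr (\<eta> - 2)"
      by (simp flip: powr_add)
    finally have 1: "c / s\<^sup>2 * (H * (3 * s) powr \<alpha> * (real (znorm y) + 3 * s) powr (\<eta> - \<alpha>))
        \<le> (3 * c * \<delta> powr (\<alpha> - 2) * (6 * d * l) powr (\<eta> - \<alpha>)) * H * R powr (\<eta> - 2)" .
    have 2: "K * s powr (\<eta> - 2) \<le> \<delta> powr (\<eta> - 2) * K * R powr (\<eta> - 2)"
      using mult_left_mono[OF sp[of "\<eta> - 2"] K] ex by (simp add: mult_ac)
    define X Y where "X = \<delta> powr (\<eta> - 2)" and "Y = 3 * c * \<delta> powr (\<alpha> - 2) * (6 * d * l) powr (\<eta> - \<alpha>)"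
    have XY: "X \<ge> 0" "Y \<ge> 0" using c by (auto simp: X_def Y_def)
    have "X * K + Y * H \<le> (X + Y) * (K + H)"
      using XY K H by (simp add: algebra_simps)
    then have "(X * K + Y * H) * R powr (\<eta> - 2) \<le> F"
      unfolding F_def F1_def X_def[symmetric] l_def[symmetric] Y_def[symmetric] by (intro mult_right_mono) auto
    then show ?thesis using bds(2)[of y] 1 2 unfolding X_def[symmetric] Y_def[symmetric] by (simp add: algebra_simps)
  qed
  have "M > 0" "F \<ge> 0" using N d1 l1 R1 F10 K H by (auto simp: M_def F_def)
  moreover have "r \<le> CARD('d) * m" unfolding m_def using L by simp
  ultimately obtain a b where ab: "\<And>y. znorm y \<le> r \<Longrightarrow>
     \<bar>w y - a - (\<Sum>j\<in>UNIV. b j * real_of_int (y$j))\<bar>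
       \<le> 80 * (d + 1)^6 * (M * (real r / real m)\<^sup>2 + F * (real m)\<^sup>2)"
    unfolding d_def using poisson_affine_approx[OF m1 _ _ wM wF, of r] by blast
  have Mq: "M * (real r / real m)\<^sup>2 = N * ((6 * d) powr \<eta> * l powr (\<eta> - 2)) * R powr \<eta>"
  proof -
    have "real r / real m = 1 / l" using R1 by (simp add: m R_def)
    then show ?thesis using d1 l1 R1 by (simp add: M_def powr_mult powr_diff power_divide)
  qed
  have Fm: "F * (real m)\<^sup>2 = F1 * l\<^sup>2 * (K + H) * R powr \<eta>"
    using R1 by (simp add: F_def m powr_diff power_mult_distrib)
  show ?thesis
  proof (intro exI[of _ a] exI[of _ b] allI impI)
    fix y :: "int^'d" assume y: "znorm y \<le> r"
    \<comment> \<open>Either s = 1 and mollification changes nothing, or s = \<delta> R and the term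
      N s^\<eta> carries the factor \<delta>^\<eta>. The 4 bounds 2^(\<eta> - \<alpha>).\<close>
    have "\<bar>w y - u y\<bar> \<le> (N * \<delta> powr \<eta> + 4 * (K + H)) * R powr \<eta>"
    proof (cases "s = 1")
      case True
      then show ?thesis using mollify_unit_scale[OF \<kappa> True, of u y] N K H by (simp add: w_def)
    next
      case False
      then have sd: "s = \<delta> * R" by (auto simp: s_def)
      have "s powr \<alpha> * (real (znorm y) + s) powr (\<eta> - \<alpha>) \<le> R powr \<alpha> * (2 * R) powr (\<eta> - \<alpha>)"
        using s y ex by (intro mult_mono powr_mono2) (auto simp: R_def)
      also have "\<dots> = 2 powr (\<eta> - \<alpha>) * R powr \<eta>" using R1 by (simp add: powr_mult powr_diff)
      also have "\<dots> \<le> 4 * R powr \<eta>"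
        using powr_mono[of "\<eta> - \<alpha>" 2 2] ex by (intro mult_right_mono) auto
      finally have "H * (s powr \<alpha> * (real (znorm y) + s) powr (\<eta> - \<alpha>)) \<le> H * (4 * R powr \<eta>)"
        using H by (intro mult_left_mono)
      also have "\<dots> \<le> (K + H) * (4 * R powr \<eta>)" using K by (intro mult_right_mono) auto
      finally have "H * (s powr \<alpha> * (real (znorm y) + s) powr (\<eta> - \<alpha>)) \<le> (K + H) * (4 * R powr \<eta>)" .
      then show ?thesis using bds(1)[of y] \<delta> R1 by (simp add: sd powr_mult algebra_simps)
    qed
    then have "\<bar>u y - a - (\<Sum>j\<in>UNIV. b j * real_of_int (y$j))\<bar>
      \<le> 80 * (d + 1)^6 * (N * ((6 * d) powr \<eta> * l powr (\<eta> - 2)) * R powr \<eta> + F1 * l\<^sup>2 * (K + H) * R powr \<eta>)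
        + (N * \<delta> powr \<eta> + 4 * (K + H)) * R powr \<eta>"
      using ab[OF y] unfolding Mq Fm by linarith
    also have "\<dots> = (N * (80 * (d + 1)^6 * (6 * d) powr \<eta> * l powr (\<eta> - 2) + \<delta> powr \<eta>)
        + (80 * (d + 1)^6 * F1 * l\<^sup>2 + 4) * (K + H)) * R powr \<eta>"
      by (simp add: algebra_simps)
    finally show "\<bar>U x (x + y) - a - (\<Sum>j\<in>UNIV. b j * real_of_int (y$j))\<bar>
     \<le> (N * (80 * (d + 1)^6 * (6 * d) powr \<eta> * real L powr (\<eta> - 2) + \<delta> powr \<eta>)
        + (80 * (d + 1)^6 * F1 * (real L)\<^sup>2 + 4) * (K + H)) * real r powr \<eta>"
      by (simp add: u_def l_def R_def)
  qed
qed

end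

text \<open>\<open>G\<close> is the constant of \<open>growth_from_affine_approx\<close> and
  \<open>c1\<close> the coefficient of N L^(\<eta> - 2). Both depend only on \<eta> and the
  dimension, so L and \<delta> can be fixed before the germ is given; each of the two terms with N
  is made at most N / 8.\<close>

lemma zgerm_improvement:
  fixes \<alpha> \<eta> c :: real
  assumes ex: "0 < \<alpha>" "\<alpha> < 1" "1 < \<eta>" "\<eta> < 2" and c: "0 \<le> c"
  shows "\<exists>C>0. \<forall>(U :: int^'d \<Rightarrow> int^'d \<Rightarrow> real) \<kappa> N H K. zgerm U \<kappa> \<alpha> \<eta> N H K c \<longrightarrow>
     (\<forall>x y. \<bar>U x y\<bar> \<le> (N / 4 + C * (K + H)) * real (znorm (x - y)) powr \<eta>)"
proof -
  define d where "d = real CARD('d)"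
  define G where "G = (4 + 2 * (1 + 2 powr \<eta>) / (2 powr (\<eta> - 1) - 1)) * 2 powr \<eta>"
  have "2 powr (\<eta> - 1) > 1" using ex powr_less_mono[of 0 "\<eta> - 1" 2] by simp
  moreover have "2 powr \<eta> \<ge> 1" using ex powr_mono[of 0 \<eta> 2] by simp
  ultimately have G1: "G \<ge> 1" unfolding G_def
    by (intro mult_ge1_I) (auto simp: field_simps intro: add_increasing2)
  define c1 where "c1 = 80 * (d + 1)^6 * (6 * d) powr \<eta>"
  have c1: "c1 \<ge> 0" by (simp add: c1_def d_def)
  have "(\<lambda>L. real L powr (\<eta> - 2)) \<longlonglongrightarrow> 0"
    using ex by (intro tendsto_neg_powr filterlim_real_sequentially) auto
  then have "(\<lambda>L. G * c1 * real L powr (\<eta> - 2)) \<longlonglongrightarrow> 0"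
    by (rule tendsto_mult_right_zero)
  then have "\<forall>\<^sub>F L in sequentially. G * c1 * real L powr (\<eta> - 2) < 1 / 8"
    by (rule order_tendstoD) simp
  then obtain L where L: "L \<ge> 1" "G * c1 * real L powr (\<eta> - 2) < 1 / 8"
    unfolding eventually_sequentially by (metis max.cobounded1 max.cobounded2)
  \<comment> \<open>As \<eta> > 1 and \<delta> \<le> 1, one has \<delta>^\<eta> \<le> \<delta>, so
    this value already gives G \<delta>^\<eta> \<le> 1/8.\<close>
  define \<delta> where "\<delta> = 1 / (8 * G)"
  have \<delta>: "0 < \<delta>" "\<delta> \<le> 1" using G1 by (auto simp: \<delta>_def)
  have "\<delta> powr \<eta> \<le> \<delta>" using powr_mono'[of 1 \<eta> \<delta>] \<delta> ex by simp
  then have G\<delta>: "G * \<delta> powr \<eta> \<le> 1 / 8" using G1 by (simp add: \<delta>_def field_simps)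
  define F1 where "F1 = \<delta> powr (\<eta> - 2) + 3 * c * \<delta> powr (\<alpha> - 2) * (6 * d * real L) powr (\<eta> - \<alpha>)"
  define C2 where "C2 = 80 * (d + 1)^6 * F1 * (real L)\<^sup>2 + 4"
  have "C2 > 0" unfolding C2_def F1_def using c by (intro add_nonneg_pos) (auto simp: d_def)
  then have GC: "G * C2 > 0" using G1 by simp
  show ?thesis
  proof (rule exI[of _ "G * C2"], intro conjI allI impI GC)
    fix U :: "int^'d \<Rightarrow> int^'d \<Rightarrow> real" and \<kappa> N H K x y
    assume "zgerm U \<kappa> \<alpha> \<eta> N H K c"
    then interpret zgerm U \<kappa> \<alpha> \<eta> N H K c .
    define A where "A = N * (c1 * real L powr (\<eta> - 2) + \<delta> powr \<eta>) + C2 * (K + H)"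
    have "A \<ge> 0" unfolding A_def using N H K c1 \<open>C2 > 0\<close> by simp
    moreover have "\<exists>a b. \<forall>z. znorm z \<le> 2^k \<longrightarrow>
        \<bar>U x (x + z) - a - (\<Sum>j\<in>UNIV. b j * real_of_int (z$j))\<bar> \<le> A * (2^k) powr \<eta>" for k
      using affine_approx_scale[of "2^k" L \<delta> x] L \<delta>
      unfolding A_def c1_def C2_def F1_def d_def by simp
    ultimately have "\<bar>U x (x + (y - x))\<bar> \<le> G * A * real (znorm (y - x)) powr \<eta>"
      unfolding G_def using ex center by (intro growth_from_affine_approx) auto
    moreover have "G * A \<le> N / 4 + G * C2 * (K + H)"
    proof -
      have "G * A = N * (G * c1 * real L powr (\<eta> - 2) + G * \<delta> powr \<eta>) + G * C2 * (K + H)"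
        by (simp add: A_def algebra_simps)
      moreover have "N * (G * c1 * real L powr (\<eta> - 2) + G * \<delta> powr \<eta>) \<le> N * (1/4)"
        using N L(2) G\<delta> by (intro mult_left_mono) auto
      ultimately show ?thesis by simp
    qed
    then have "G * A * real (znorm (y - x)) powr \<eta> \<le> (N / 4 + G * C2 * (K + H)) * real (znorm (y - x)) powr \<eta>"
      by (intro mult_right_mono) auto
    ultimately show "\<bar>U x y\<bar> \<le> (N / 4 + G * C2 * (K + H)) * real (znorm (x - y)) powr \<eta>"
      by (simp add: znorm_minus_commute)
  qed
qed

section \<open>Smooth test functions\<close>

text \<open>With w = 1 / (1 - t^2) and w' = 2 t w^2, differentiating p w^(2n) exp(-w) and factoring
  out w^(2n+2) gives this recursion for the polynomial factor.\<close>

primrec bump_poly :: "nat \<Rightarrow> real poly" where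
  "bump_poly 0 = 1"
| "bump_poly (Suc n) = pderiv (bump_poly n) * [:1, 0, -1:]\<^sup>2
     + smult (real (4 * n)) ([:0, 1:] * [:1, 0, -1:] * bump_poly n) - [:0, 2:] * bump_poly n"

text \<open>The \<open>n\<close>-th derivative of \<open>exp (- 1 / (1 - t\<^sup>2))\<close>.\<close>

definition bump :: "nat \<Rightarrow> real \<Rightarrow> real" where
  "bump n t = (if \<bar>t\<bar> < 1 then poly (bump_poly n) t * inverse (1 - t\<^sup>2) ^ (2 * n) * exp (- inverse (1 - t\<^sup>2)) else 0)"

text \<open>The exponential series gives exp w \<ge> w^k / k!. With k = 2 n + 2 the powers of w in
  \<open>bump n\<close> are cancelled and w^(-2) is left over. Quadratic vanishing at both endpoints
  is what differentiability there requires.\<close>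

lemma bump_quadratic: "\<exists>C. \<forall>t. \<bar>bump n t\<bar> \<le> C * (1 - t\<^sup>2)\<^sup>2"
proof -
  have "bounded (poly (bump_poly n) ` {-1..1::real})"
    by (intro compact_imp_bounded compact_continuous_image continuous_intros) auto
  then obtain B where B: "\<And>t. \<bar>t\<bar> \<le> 1 \<Longrightarrow> \<bar>poly (bump_poly n) t\<bar> \<le> B"
    unfolding bounded_iff by (metis abs_le_iff atLeastAtMost_iff image_eqI minus_le_iff real_norm_def)
  have B0: "B \<ge> 0" using B[of 0] by simp
  define k where "k = 2 * n + 2"
  have "\<bar>bump n t\<bar> \<le> B * fact k * (1 - t\<^sup>2)\<^sup>2" for t
  proof (cases "\<bar>t\<bar> < 1")
    case True
    define w where "w = inverse (1 - t\<^sup>2)"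
    have t: "1 - t\<^sup>2 > 0" using True by (simp add: abs_square_less_1)
    then have w: "w > 0" "w * (1 - t\<^sup>2) = 1" by (simp_all add: w_def)
    have "w ^ k / fact k \<le> exp w"
    proof -
      have e: "(\<lambda>i. w ^ i /\<^sub>R fact i) sums exp w" by (rule exp_converges)
      have "(\<Sum>i\<in>{k}. w ^ i /\<^sub>R fact i) \<le> (\<Sum>i. w ^ i /\<^sub>R fact i)"
        by (rule sum_le_suminf) (use e w in \<open>auto simp: sums_iff\<close>)
      also have "\<dots> = exp w" using e by (simp add: sums_iff)
      finally show ?thesis by (simp add: divide_inverse_commute)
    qed
    then have "w ^ k * exp (- w) \<le> fact k" by (simp add: exp_minus field_simps)
    then have "w ^ k * exp (- w) * (1 - t\<^sup>2)\<^sup>2 \<le> fact k * (1 - t\<^sup>2)\<^sup>2" by (intro mult_right_mono) auto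
    moreover have "w ^ k * exp (- w) * (1 - t\<^sup>2)\<^sup>2 = w ^ (2 * n) * exp (- w) * (w * (1 - t\<^sup>2))\<^sup>2"
      by (simp only: k_def power_add power_mult_distrib) simp
    ultimately have le: "w ^ (2 * n) * exp (- w) \<le> fact k * (1 - t\<^sup>2)\<^sup>2" using w(2) by simp
    have "\<bar>bump n t\<bar> = \<bar>poly (bump_poly n) t\<bar> * (w ^ (2 * n) * exp (- w))"
      using True w by (simp add: bump_def w_def[symmetric] abs_mult)
    also have "\<dots> \<le> B * (fact k * (1 - t\<^sup>2)\<^sup>2)"
      by (intro mult_mono le) (use B[of t] True B0 w in auto)
    finally show ?thesis by simp
  qed (use B0 in \<open>simp add: bump_def\<close>)
  then show ?thesis by blast
qed

lemma bump_bounded: "\<exists>C. \<forall>t. \<bar>bump n t\<bar> \<le> C"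
proof -
  obtain C where C: "\<And>t. \<bar>bump n t\<bar> \<le> C * (1 - t\<^sup>2)\<^sup>2" using bump_quadratic by blast
  have C0: "C \<ge> 0" using C[of 0] by simp
  have "\<bar>bump n t\<bar> \<le> C" for t
  proof (cases "\<bar>t\<bar> < 1")
    case True
    then have "0 \<le> 1 - t\<^sup>2" "1 - t\<^sup>2 \<le> 1" by (simp_all add: abs_square_le_1)
    then have "(1 - t\<^sup>2)\<^sup>2 \<le> 1" by (simp add: power_le_one)
    then show ?thesis using C[of t] C0 mult_left_mono[of "(1 - t\<^sup>2)\<^sup>2" 1 C] by linarith
  qed (use C0 in \<open>simp add: bump_def\<close>)
  then show ?thesis by blast
qed

lemma DERIV_zero_of_quadratic:
  fixes f :: "real \<Rightarrow> real"
  assumes "\<And>t. \<bar>f t\<bar> \<le> C * (t - a)\<^sup>2"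
  shows "(f has_real_derivative 0) (at a)"
  unfolding DERIV_def
proof (rule Lim_null_comparison)
  have fa: "f a = 0" using assms[of a] by simp
  show "((\<lambda>h. C * \<bar>h\<bar>) \<longlongrightarrow> 0) (at 0)"
    by (intro tendsto_eq_intros | simp)+
  show "\<forall>\<^sub>F h in at 0. norm ((f (a + h) - f a) / h) \<le> C * \<bar>h\<bar>"
    unfolding eventually_at_filter
  proof (intro always_eventually allI impI)
    fix h :: real assume "h \<noteq> 0"
    then show "norm ((f (a + h) - f a) / h) \<le> C * \<bar>h\<bar>"
      using assms[of "a + h"] by (simp add: fa divide_le_eq power2_eq_square mult.assoc)
  qed
qed

lemma DERIV_bump: "(bump n has_real_derivative bump (Suc n) t) (at t)"
proof (cases "\<bar>t\<bar> < 1")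
  case True
  define w where "w = (\<lambda>t::real. inverse (1 - t\<^sup>2))"
  have t: "1 - t\<^sup>2 > 0" using True by (simp add: abs_square_less_1)
  then have w1: "w t * (1 - t\<^sup>2) = 1" by (simp add: w_def)
  have dw: "(w has_real_derivative 2 * t * (w t)\<^sup>2) (at t)"
    unfolding w_def using t by (auto intro!: derivative_eq_intros simp: power2_eq_square)
  define D where "D = (poly (pderiv (bump_poly n)) t * w t ^ (2 * n)
     + poly (bump_poly n) t * (real (2 * n) * (w t ^ (2 * n - 1) * (2 * t * (w t)\<^sup>2)))) * exp (- w t)
     - poly (bump_poly n) t * w t ^ (2 * n) * (exp (- w t) * (2 * t * (w t)\<^sup>2))"
  have "((\<lambda>t. poly (bump_poly n) t * w t ^ (2 * n) * exp (- w t)) has_real_derivative D) (at t)"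
    unfolding D_def by (rule derivative_eq_intros dw poly_DERIV refl | simp)+
  moreover have "D = bump (Suc n) t"
  proof -
    define W where "W = w t"
    define a where "a = 1 - t\<^sup>2"
    have Wa: "W * a = 1" using w1 by (simp add: W_def a_def)
    have p: "real (2 * n) * (W ^ (2 * n - 1) * (2 * t * W\<^sup>2)) = 4 * real n * t * (W ^ (2 * n) * W)"
      by (cases n) (auto simp: power2_eq_square)
    have q: "poly (bump_poly (Suc n)) t = poly (pderiv (bump_poly n)) t * a\<^sup>2 + 4 * real n * t * a * poly (bump_poly n) t - 2 * t * poly (bump_poly n) t"
      by (simp add: a_def power2_eq_square algebra_simps)
    have "W ^ (2 * Suc n) = W ^ (2 * n) * W\<^sup>2" by (simp add: power2_eq_square)
    then have "bump (Suc n) t = poly (bump_poly (Suc n)) t * (W ^ (2 * n) * W\<^sup>2) * exp (- W)"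
      using True by (simp only: bump_def W_def w_def if_True)
    also have "\<dots> = (poly (pderiv (bump_poly n)) t * (W * a)\<^sup>2 + 4 * real n * t * (W * a) * W * poly (bump_poly n) t
       - 2 * t * W\<^sup>2 * poly (bump_poly n) t) * W ^ (2 * n) * exp (- W)"
      unfolding q by (simp add: power2_eq_square algebra_simps)
    also have "\<dots> = D"
      unfolding D_def W_def[symmetric] p Wa by (simp add: algebra_simps)
    finally show ?thesis ..
  qed
  ultimately have D: "((\<lambda>t. poly (bump_poly n) t * w t ^ (2 * n) * exp (- w t)) has_real_derivative bump (Suc n) t) (at t)"
    by simp
  show ?thesis
    by (rule has_field_derivative_transform_within_open[OF D, of "{-1<..<1}"])
      (use True in \<open>auto simp: bump_def w_def\<close>)
next
  case False
  obtain C where C: "\<And>t. \<bar>bump n t\<bar> \<le> C * (1 - t\<^sup>2)\<^sup>2" using bump_quadratic by blast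
  have C0: "C \<ge> 0" using C[of 0] by simp
  \<comment> \<open>For |s| < 1 \<le> |t| the factorisation gives 1 - s^2 \<le> 2 |s - t|. This
    treats the endpoints and the exterior at once.\<close>
  have "\<bar>bump n s\<bar> \<le> (C * 4) * (s - t)\<^sup>2" for s
  proof (cases "\<bar>s\<bar> < 1")
    case True
    have "1 - s\<^sup>2 = (1 - \<bar>s\<bar>) * (1 + \<bar>s\<bar>)" by (simp add: algebra_simps power2_eq_square)
    also have "\<dots> \<le> \<bar>s - t\<bar> * 2" using True False by (intro mult_mono) auto
    finally have "(1 - s\<^sup>2)\<^sup>2 \<le> (\<bar>s - t\<bar> * 2)\<^sup>2"
      using True by (intro power_mono) (simp_all add: abs_square_le_1)
    then have "C * (1 - s\<^sup>2)\<^sup>2 \<le> C * (4 * (s - t)\<^sup>2)"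
      using C0 by (intro mult_left_mono) (auto simp: power_mult_distrib)
    then show ?thesis using C[of s] by simp
  qed (use C0 in \<open>simp add: bump_def\<close>)
  then have "(bump n has_real_derivative 0) (at t)" by (rule DERIV_zero_of_quadratic)
  then show ?thesis using False by (simp add: bump_def)
qed

lemma bump_0_properties:
  shows "\<bar>t\<bar> \<ge> 1 \<Longrightarrow> bump 0 t = 0" "0 \<le> bump 0 t" "bump 0 t \<le> 1" "bump 0 (- t) = bump 0 t"
    "\<bar>t\<bar> \<le> 1/2 \<Longrightarrow> exp (- 4/3) \<le> bump 0 t"
proof -
  show "bump 0 t \<le> 1" using abs_square_less_1[of t] by (auto simp: bump_def)
  assume "\<bar>t\<bar> \<le> 1/2"
  then have "t\<^sup>2 \<le> (1/2)\<^sup>2" by (metis abs_le_square_iff abs_of_nonneg zero_le_divide_1_iff zero_le_numeral)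
  then have "inverse (1 - t\<^sup>2) \<le> 4/3" by (simp add: field_simps power2_eq_square)
  then show "exp (- 4/3) \<le> bump 0 t" using \<open>\<bar>t\<bar> \<le> 1/2\<close> by (auto simp: bump_def)
qed (auto simp: bump_def)

text \<open>The symmetric sum k -> g 0 (t + k) + g 0 (t - k) has derivative g 1 (t + k) - g 1 (t -
  k), which is at most 2 B |k|; the mean value inequality is thus used twice.\<close>

lemma second_difference_bound:
  fixes g :: "nat \<Rightarrow> real \<Rightarrow> real"
  assumes g: "\<And>n t. (g n has_real_derivative g (Suc n) t) (at t)"
    and B: "\<And>t. \<bar>g 2 t\<bar> \<le> B"
  shows "\<bar>g 0 (t + h) + g 0 (t - h) - 2 * g 0 t\<bar> \<le> 2 * B * h\<^sup>2"
proof -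
  have B0: "B \<ge> 0" using B[of 0] by linarith
  have g': "(g 0 has_real_derivative g 1 t) (at t)" "(g 1 has_real_derivative g 2 t) (at t)" for t
    using g[of 0 t] g[of 1 t] by (simp_all add: numeral_2_eq_2)
  have *: "\<bar>g 1 a - g 1 b\<bar> \<le> B * \<bar>a - b\<bar>" for a b
    using field_differentiable_bound[of UNIV "g 1" "g 2" B a b] g' B by auto
  define f where "f = (\<lambda>k. g 0 (t + k) + g 0 (t - k))"
  have "norm (f h - f 0) \<le> (2 * B * \<bar>h\<bar>) * norm (h - 0)"
  proof (rule field_differentiable_bound[where S = "{-\<bar>h\<bar>..\<bar>h\<bar>}"])
    fix k assume k: "k \<in> {-\<bar>h\<bar>..\<bar>h\<bar>}"
    have "((\<lambda>k. g 0 (t + k)) has_real_derivative g 1 (t + k) * 1) (at k)"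
      by (rule DERIV_chain2[OF g'(1)]) (auto intro!: derivative_eq_intros)
    moreover have "((\<lambda>k. g 0 (t - k)) has_real_derivative g 1 (t - k) * (- 1)) (at k)"
      by (rule DERIV_chain2[OF g'(1)]) (auto intro!: derivative_eq_intros)
    ultimately have "(f has_real_derivative g 1 (t + k) * 1 + g 1 (t - k) * (- 1)) (at k)"
      unfolding f_def by (rule DERIV_add)
    then show "(f has_real_derivative g 1 (t + k) - g 1 (t - k)) (at k within {-\<bar>h\<bar>..\<bar>h\<bar>})"
      by (simp add: has_field_derivative_at_within)
    have "\<bar>g 1 (t + k) - g 1 (t - k)\<bar> \<le> B * \<bar>2 * k\<bar>" using *[of "t + k" "t - k"] by simp
    also have "\<dots> \<le> B * (2 * \<bar>h\<bar>)" using k B0 by (intro mult_left_mono) auto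
    finally show "norm (g 1 (t + k) - g 1 (t - k)) \<le> 2 * B * \<bar>h\<bar>" by simp
  qed auto
  then show ?thesis by (simp add: f_def power2_eq_square mult.assoc)
qed

text \<open>\<open>k i\<close> counts the derivatives taken in coordinate i. Products of this shape
  are closed under \<open>partial\<close>, so all iterated partial derivatives have an explicit form
  and are differentiable.\<close>

lemma partial_prod:
  fixes g :: "nat \<Rightarrow> real \<Rightarrow> real" and x :: "real^'d"
  assumes g: "\<And>n t. (g n has_real_derivative g (Suc n) t) (at t)"
  shows "(\<lambda>x::real^'d. c * (\<Prod>i\<in>UNIV. g (k i) (x$i))) differentiable (at x)"
    and "partial j (\<lambda>x. c * (\<Prod>i\<in>UNIV. g (k i) (x$i))) x
      = c * (\<Prod>i\<in>UNIV. g (if j = i then Suc (k i) else k i) (x$i))"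
proof -
  have 1: "((\<lambda>x::real^'d. g (k i) (x$i)) has_derivative (\<lambda>h. g (Suc (k i)) (x$i) * h$i)) (at x)" for i
    using has_derivative_compose[OF bounded_linear_imp_has_derivative[OF bounded_linear_vec_nth[of i]]
        has_field_derivative_imp_has_derivative[OF g[of "k i" "x$i"]], of UNIV]
    by simp
  have D: "((\<lambda>x::real^'d. c * (\<Prod>i\<in>UNIV. g (k i) (x$i))) has_derivative
     (\<lambda>h. c * (\<Sum>i\<in>UNIV. g (Suc (k i)) (x$i) * h$i * (\<Prod>l\<in>UNIV - {i}. g (k l) (x$l))))) (at x)"
    by (intro has_derivative_mult_right has_derivative_prod 1)
  then show "(\<lambda>x::real^'d. c * (\<Prod>i\<in>UNIV. g (k i) (x$i))) differentiable (at x)"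
    unfolding differentiable_def by blast
  have "partial j (\<lambda>x. c * (\<Prod>i\<in>UNIV. g (k i) (x$i))) x =
      c * (\<Sum>i\<in>UNIV. g (Suc (k i)) (x$i) * axis j 1 $ i * (\<Prod>l\<in>UNIV - {i}. g (k l) (x$l)))"
    unfolding partial_def frechet_derivative_at[OF D, symmetric] ..
  also have "(\<Sum>i\<in>UNIV. g (Suc (k i)) (x$i) * axis j 1 $ i * (\<Prod>l\<in>UNIV - {i}. g (k l) (x$l)))
      = (\<Sum>i\<in>UNIV. if i = j then g (Suc (k i)) (x$i) * (\<Prod>l\<in>UNIV - {i}. g (k l) (x$l)) else 0)"
    by (intro sum.cong) (auto simp: axis_def)
  also have "\<dots> = g (Suc (k j)) (x$j) * (\<Prod>l\<in>UNIV - {j}. g (k l) (x$l))" by simp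
  also have "(\<Prod>l\<in>UNIV - {j}. g (k l) (x$l)) = (\<Prod>l\<in>UNIV - {j}. g (if j = l then Suc (k l) else k l) (x$l))"
    by (intro prod.cong) auto
  also have "g (Suc (k j)) (x$j) * \<dots> = (\<Prod>i\<in>UNIV. g (if j = i then Suc (k i) else k i) (x$i))"
    by (subst prod.remove[of UNIV j]) auto
  finally show "partial j (\<lambda>x. c * (\<Prod>i\<in>UNIV. g (k i) (x$i))) x
      = c * (\<Prod>i\<in>UNIV. g (if j = i then Suc (k i) else k i) (x$i))" .
qed

lemma iter_partial_prod:
  fixes g :: "nat \<Rightarrow> real \<Rightarrow> real"
  assumes g: "\<And>n t. (g n has_real_derivative g (Suc n) t) (at t)"
  shows "iter_partial is (\<lambda>x::real^'d. c * (\<Prod>i\<in>UNIV. g 0 (x$i)))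
    = (\<lambda>x. c * (\<Prod>i\<in>UNIV. g (count_list is i) (x$i)))"
proof (induction "is")
  case (Cons j js)
  have "iter_partial (j # js) (\<lambda>x::real^'d. c * (\<Prod>i\<in>UNIV. g 0 (x$i)))
      = partial j (\<lambda>x. c * (\<Prod>i\<in>UNIV. g (count_list js i) (x$i)))"
    using Cons by (simp add: iter_partial_def)
  also have "\<dots> = (\<lambda>x. c * (\<Prod>i\<in>UNIV. g (count_list (j # js) i) (x$i)))"
  proof
    fix x :: "real^'d"
    show "partial j (\<lambda>x. c * (\<Prod>i\<in>UNIV. g (count_list js i) (x$i))) x = c * (\<Prod>i\<in>UNIV. g (count_list (j # js) i) (x$i))"
      unfolding partial_prod(2)[of g, OF g]
      by (intro arg_cong2[of _ _ _ _ "(*)"] prod.cong refl) auto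
  qed
  finally show ?case .
qed (simp add: iter_partial_def)

text \<open>A product of one-dimensional bumps squeezed by A = 2 d, so that the support lies in a
  cube inside the l1 ball of radius 1/2. The lower bound on the half-size cube will bound the
  discrete mass from below, and the second-difference bound will control the discrete Laplacian of
  the kernel.\<close>

lemma test_function_exists:
  assumes "\<bar>\<gamma>\<bar> \<le> 1"
  shows "\<exists>\<psi>::real^'d \<Rightarrow> real. \<exists>m B. \<psi> \<in> test_class \<gamma> \<and> m > 0 \<and> (\<forall>x. 0 \<le> \<psi> x) \<and> (\<forall>x. \<psi> (- x) = \<psi> x) \<and>
    (\<forall>x i. \<bar>x$i\<bar> \<ge> 1 / (2 * real CARD('d)) \<longrightarrow> \<psi> x = 0) \<and>
    (\<forall>x. (\<forall>i. \<bar>x$i\<bar> \<le> 1 / (4 * real CARD('d))) \<longrightarrow> m \<le> \<psi> x) \<and>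
    (\<forall>x i h. \<bar>\<psi> (x + axis i h) + \<psi> (x - axis i h) - 2 * \<psi> x\<bar> \<le> B * h\<^sup>2)"
proof -
  define d where "d = real CARD('d)"
  have d1: "d \<ge> 1" unfolding d_def by (simp add: Suc_leI)
  define A where "A = 2 * d"
  have A: "A > 0" using d1 by (simp add: A_def)
  define g where "g n t = A ^ n * bump n (A * t)" for n t
  have g: "(g n has_real_derivative g (Suc n) t) (at t)" for n t
  proof -
    have "((\<lambda>t. bump n (A * t)) has_real_derivative bump (Suc n) (A * t) * A) (at t)"
      by (rule DERIV_chain2[OF DERIV_bump]) (auto intro!: derivative_eq_intros)
    from DERIV_cmult[OF this, of "A ^ n"] show ?thesis by (simp add: g_def[abs_def] mult_ac)
  qed
  have gB: "\<exists>B. \<forall>t. \<bar>g n t\<bar> \<le> B" for n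
  proof -
    obtain C where C: "\<And>t. \<bar>bump n t\<bar> \<le> C" using bump_bounded by blast
    have "\<bar>g n t\<bar> \<le> A ^ n * C" for t
      using C[of "A * t"] A by (simp add: g_def abs_mult)
    then show ?thesis by blast
  qed
  obtain B1 where B1: "\<And>t. \<bar>g 1 t\<bar> \<le> B1" using gB by blast
  obtain B2 where B2: "\<And>t. \<bar>g 2 t\<bar> \<le> B2" using gB by blast
  have g0: "0 \<le> g 0 t" "g 0 t \<le> 1" "g 0 (- t) = g 0 t" for t
    by (simp_all add: g_def bump_0_properties)
  have gz: "g 0 t = 0" if "\<bar>t\<bar> \<ge> 1 / (2 * d)" for t
    using that d1 by (simp add: g_def A_def bump_0_properties(1) abs_mult divide_le_eq mult.commute)
  have gl: "exp (- 4/3) \<le> g 0 t" if "\<bar>t\<bar> \<le> 1 / (4 * d)" for t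
    using that d1 bump_0_properties(5)[of "A * t"] by (simp add: g_def A_def abs_mult field_simps)
  \<comment> \<open>Only orders 0 and 1 are constrained since |\<gamma>| \<le> 1; at most one factor
    is then differentiated, and \<open>max 1 B1\<close> bounds the whole product.\<close>
  define c where "c = 1 / max 1 B1"
  have c: "c > 0" "c \<le> 1" "c * max 1 B1 = 1" by (auto simp: c_def)
  define \<psi> :: "real^'d \<Rightarrow> real" where "\<psi> = (\<lambda>x. c * (\<Prod>i\<in>UNIV. g 0 (x$i)))"
  have it: "iter_partial is \<psi> = (\<lambda>x. c * (\<Prod>i\<in>UNIV. g (count_list is i) (x$i)))" for "is"
    unfolding \<psi>_def by (rule iter_partial_prod) (rule g)
  have pz: "\<psi> x = 0" if "\<bar>x$i\<bar> \<ge> 1 / (2 * d)" for x i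
    unfolding \<psi>_def using gz[OF that] by (auto intro!: prod_zero)
  have p0: "0 \<le> \<psi> x" for x unfolding \<psi>_def using c g0 by (auto intro!: mult_nonneg_nonneg prod_nonneg)
  have supp: "closure {x. \<psi> x \<noteq> 0} \<subseteq> {x. \<forall>i. \<bar>x$i\<bar> \<le> 1 / (2 * d)}"
  proof (rule closure_minimal)
    show "{x. \<psi> x \<noteq> 0} \<subseteq> {x. \<forall>i. \<bar>x$i\<bar> \<le> 1 / (2 * d)}"
      using pz by (auto simp: not_le) (meson linorder_le_cases)
    show "closed {x::real^'d. \<forall>i. \<bar>x$i\<bar> \<le> 1 / (2 * d)}"
      by (intro closed_Collect_all closed_Collect_le continuous_intros)
  qed
  have tc: "\<psi> \<in> test_class \<gamma>"
    unfolding test_class_def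
  proof (intro CollectI conjI allI impI)
    show "smooth_fn \<psi>" unfolding smooth_fn_def it by (intro allI partial_prod(1) g)
    have "closure {x. \<psi> x \<noteq> 0} \<subseteq> cbox (\<chi> i. - (1 / (2 * d))) (\<chi> i. 1 / (2 * d))"
      using supp by (auto simp: mem_box_cart abs_le_iff subset_iff minus_le_iff)
    then have "bounded (closure {x. \<psi> x \<noteq> 0})" using bounded_cbox bounded_subset by blast
    then show "compact (closure {x. \<psi> x \<noteq> 0})" by (simp add: compact_eq_bounded_closed)
    show "closure {x. \<psi> x \<noteq> 0} \<subseteq> {x. l1dist 0 x < 1}"
    proof
      fix x assume "x \<in> closure {x. \<psi> x \<noteq> 0}"
      then have "\<bar>x$i\<bar> \<le> 1 / (2 * d)" for i using supp by auto
      then have "l1dist 0 x \<le> (\<Sum>i\<in>(UNIV::'d set). 1 / (2 * d))"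
        unfolding l1dist_def by (intro sum_mono) auto
      also have "\<dots> = 1 / 2" using d1 by (simp add: d_def)
      finally show "x \<in> {x. l1dist 0 x < 1}" by simp
    qed
    fix "is" :: "'d list" and x
    assume len: "length is \<le> nat \<lceil>\<bar>\<gamma>\<bar>\<rceil>"
    have "nat \<lceil>\<bar>\<gamma>\<bar>\<rceil> \<le> 1" using assms by (simp add: ceiling_le_iff)
    then consider "is = []" | j where "is = [j]"
      using len by (cases "is") (auto simp: le_Suc_eq)
    then obtain j where bd: "\<And>i. \<bar>g (count_list is i) (x$i)\<bar> \<le> (if i = j then max 1 B1 else 1)"
    proof cases
      case 1 then show thesis using that[of undefined] g0 by (auto simp: max_def) (smt (verit))
    next
      case (2 j)
      then show thesis using that[of j] g0 B1 by (auto simp: le_max_iff_disj)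
    qed
    have "(\<Prod>i\<in>UNIV. \<bar>g (count_list is i) (x$i)\<bar>) \<le> (\<Prod>i\<in>UNIV. if i = j then max 1 B1 else 1)"
      by (intro prod_mono) (use bd in auto)
    also have "\<dots> = max 1 B1" by simp
    finally have "c * (\<Prod>i\<in>UNIV. \<bar>g (count_list is i) (x$i)\<bar>) \<le> c * max 1 B1"
      using c by (intro mult_left_mono) auto
    then show "\<bar>iter_partial is \<psi> x\<bar> \<le> 1" using c by (simp add: it abs_mult abs_prod)
  qed
  have pe: "\<psi> (- x) = \<psi> x" for x by (simp add: \<psi>_def g0)
  have pl: "c * exp (- 4/3) ^ CARD('d) \<le> \<psi> x" if "\<And>i. \<bar>x$i\<bar> \<le> 1 / (4 * d)" for x
  proof -
    have "(\<Prod>i\<in>(UNIV::'d set). exp (- 4/3)) \<le> (\<Prod>i\<in>UNIV. g 0 (x$i))"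
      by (intro prod_mono) (use gl[OF that] in auto)
    then show ?thesis unfolding \<psi>_def using c by (simp add: mult_left_mono)
  qed
  have pd: "\<bar>\<psi> (x + axis i h) + \<psi> (x - axis i h) - 2 * \<psi> x\<bar> \<le> 2 * B2 * h\<^sup>2" for x i h
  proof -
    define P where "P = (\<Prod>l\<in>UNIV - {i}. g 0 (x$l))"
    have "0 \<le> P" "P \<le> 1" unfolding P_def by (intro prod_nonneg prod_le_1; simp add: g0)+
    then have cP: "0 \<le> c * P" "c * P \<le> 1" using c by (auto simp: mult_le_one)
    have e: "\<psi> (x + axis i k) = c * P * g 0 (x$i + k)" for k
    proof -
      have "(\<Prod>l\<in>UNIV. g 0 ((x + axis i k)$l)) = g 0 ((x + axis i k)$i) * (\<Prod>l\<in>UNIV - {i}. g 0 ((x + axis i k)$l))"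
        by (rule prod.remove) auto
      also have "(\<Prod>l\<in>UNIV - {i}. g 0 ((x + axis i k)$l)) = P"
        unfolding P_def by (intro prod.cong) (auto simp: axis_def)
      finally show ?thesis by (simp add: \<psi>_def axis_def)
    qed
    have "axis i (- h) = - axis i h" by (simp add: axis_def vec_eq_iff)
    then have "\<psi> (x - axis i h) = c * P * g 0 (x$i - h)" using e[of "- h"] by simp
    moreover have "x + axis i 0 = x" by (simp add: axis_def vec_eq_iff)
    then have "\<psi> x = c * P * g 0 (x$i)" using e[of 0] by (simp only: add_0_right)
    ultimately have "\<psi> (x + axis i h) + \<psi> (x - axis i h) - 2 * \<psi> x
        = c * P * (g 0 (x$i + h) + g 0 (x$i - h) - 2 * g 0 (x$i))"
      unfolding e by (simp add: algebra_simps)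
    also have "\<bar>\<dots>\<bar> \<le> 1 * (2 * B2 * h\<^sup>2)"
      unfolding abs_mult using second_difference_bound[of g, OF g B2] cP by (intro mult_mono) auto
    finally show ?thesis by simp
  qed
  show ?thesis
    by (rule exI[of _ \<psi>], rule exI[of _ "c * exp (- 4/3) ^ CARD('d)"], rule exI[of _ "2 * B2"])
      (use tc p0 pe pz pl pd c in \<open>auto simp: d_def\<close>)
qed

section \<open>Transfer to the scaled lattice\<close>

text \<open>Used in two roles: with the mesh size it parametrises the scaled lattice, and with 1 / s
  it supplies the arguments of a test function rescaled to s lattice steps.\<close>

definition zemb :: "real \<Rightarrow> int^'d \<Rightarrow> real^'d" where
  "zemb \<epsilon> z = (\<chi> i. \<epsilon> * real_of_int (z$i))"

lemma zemb_add: "zemb \<epsilon> (a + b) = zemb \<epsilon> a + zemb \<epsilon> b"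
  by (simp add: zemb_def vec_eq_iff algebra_simps)

lemma zemb_diff: "zemb \<epsilon> (a - b) = zemb \<epsilon> a - zemb \<epsilon> b"
  by (simp add: zemb_def vec_eq_iff algebra_simps)

lemma zemb_unit: "zemb \<epsilon> (zunit j) = axis j \<epsilon>"
  by (simp add: zemb_def vec_eq_iff zunit_nth axis_def)

lemma inj_zemb: "\<epsilon> > 0 \<Longrightarrow> inj (zemb \<epsilon>)"
  by (auto simp: inj_on_def zemb_def vec_eq_iff)

lemma lattice_eq_range: "lattice \<epsilon> = range (zemb \<epsilon>)"
proof safe
  fix x :: "real^'d" assume "x \<in> lattice \<epsilon>"
  then have "\<forall>i. \<exists>k::int. x$i = \<epsilon> * real_of_int k" by (simp add: lattice_def)
  then obtain k :: "'d \<Rightarrow> int" where "\<And>i. x$i = \<epsilon> * real_of_int (k i)" by (auto dest!: choice)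
  then have "x = zemb \<epsilon> (\<chi> i. k i)" by (simp add: zemb_def vec_eq_iff)
  then show "x \<in> range (zemb \<epsilon>)" by blast
qed (auto simp: lattice_def zemb_def)

lemma zemb_in_lattice [simp]: "zemb \<epsilon> z \<in> lattice \<epsilon>"
  by (simp add: lattice_eq_range)

lemma l1dist_zemb: "\<epsilon> > 0 \<Longrightarrow> l1dist (zemb \<epsilon> a) (zemb \<epsilon> b) = \<epsilon> * real (znorm (a - b))"
proof -
  assume "\<epsilon> > 0"
  then have "\<bar>\<epsilon> * real_of_int (a$i) - \<epsilon> * real_of_int (b$i)\<bar> = \<epsilon> * \<bar>real_of_int ((a - b)$i)\<bar>" for i
    by (simp add: abs_mult flip: right_diff_distrib)
  then show ?thesis by (simp only: l1dist_def zemb_def vec_lambda_beta real_znorm sum_distrib_left)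
qed

lemma znorm_eq_1_cases:
  assumes "znorm z = 1"
  obtains j where "z = zunit j \<or> z = - zunit j"
proof -
  have "z \<noteq> 0" using assms by auto
  then obtain j where "z$j \<noteq> 0" by (auto simp: vec_eq_iff)
  then consider "z$j > 0" | "(- z)$j > 0" by fastforce
  then show thesis
  proof cases
    case 1
    then show thesis using znorm_pred[OF 1] assms that[of j] by simp
  next
    case 2
    then have "znorm (- z - zunit j) = 0" using znorm_pred[OF 2] assms by simp
    then have "- z - zunit j = 0" by (simp only: znorm_eq_0_iff)
    then show thesis using that[of j] by (metis eq_iff_diff_eq_0 minus_minus)
  qed
qed

lemma disc_lap_zemb:
  fixes u :: "real^'d \<Rightarrow> complex"
  assumes \<epsilon>: "\<epsilon> > 0"
  shows "disc_lap \<epsilon> u (zemb \<epsilon> y) = complex_of_real (\<epsilon> powi (-2)) * zlap (\<lambda>z. u (zemb \<epsilon> z)) y"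
proof -
  define A B where "A = (\<lambda>j. y + zunit j) ` UNIV" and "B = (\<lambda>j. y - zunit j) ` UNIV"
  have injA: "inj (\<lambda>j. y + zunit j)" and injB: "inj (\<lambda>j. y - zunit j)"
    by (auto simp: inj_on_def vec_eq_iff zunit_nth split: if_splits)
  have "y + zunit i \<noteq> y - zunit j" for i j
  proof
    assume "y + zunit i = y - zunit j"
    then have "(y + zunit i) $ i = (y - zunit j) $ i" by simp
    then show False by (simp add: zunit_nth split: if_splits)
  qed
  then have disj: "A \<inter> B = {}" by (auto simp: A_def B_def)
  have "{z\<in>lattice \<epsilon>. l1dist (zemb \<epsilon> y) z = \<epsilon>} = zemb \<epsilon> ` (A \<union> B)"
  proof (intro equalityI subsetI)
    fix z assume "z \<in> {z\<in>lattice \<epsilon>. l1dist (zemb \<epsilon> y) z = \<epsilon>}"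
    then obtain b where b: "z = zemb \<epsilon> b" "\<epsilon> * real (znorm (y - b)) = \<epsilon>"
      by (auto simp: lattice_eq_range l1dist_zemb \<epsilon>)
    then have "znorm (y - b) = 1" using \<epsilon> by simp
    then obtain j where "y - b = zunit j \<or> y - b = - zunit j" by (rule znorm_eq_1_cases)
    then have "b = y - zunit j \<or> b = y + zunit j" by (auto simp: algebra_simps)
    then show "z \<in> zemb \<epsilon> ` (A \<union> B)" using b(1) by (auto simp: A_def B_def)
  next
    fix z assume "z \<in> zemb \<epsilon> ` (A \<union> B)"
    then show "z \<in> {z\<in>lattice \<epsilon>. l1dist (zemb \<epsilon> y) z = \<epsilon>}"
      by (auto simp: A_def B_def l1dist_zemb \<epsilon>)
  qed
  then have "(\<Sum>z\<in>{z\<in>lattice \<epsilon>. l1dist (zemb \<epsilon> y) z = \<epsilon>}. u z - u (zemb \<epsilon> y))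
      = (\<Sum>z\<in>A \<union> B. u (zemb \<epsilon> z) - u (zemb \<epsilon> y))"
    using sum.reindex[OF inj_on_subset[OF inj_zemb[OF \<epsilon>] subset_UNIV], of "\<lambda>z. u z - u (zemb \<epsilon> y)" "A \<union> B"]
    by simp
  also have "\<dots> = (\<Sum>z\<in>A. u (zemb \<epsilon> z) - u (zemb \<epsilon> y)) + (\<Sum>z\<in>B. u (zemb \<epsilon> z) - u (zemb \<epsilon> y))"
    by (rule sum.union_disjoint) (auto simp: A_def B_def disj[unfolded A_def B_def])
  also have "\<dots> = zlap (\<lambda>z. u (zemb \<epsilon> z)) y"
    unfolding A_def B_def sum.reindex[OF injA] sum.reindex[OF injB] zlap_def o_def sum.distrib[symmetric]
    by (intro sum.cong) auto
  finally show ?thesis by (simp add: disc_lap_def)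
qed

text \<open>For the radius s \<epsilon> the volume weight \<epsilon>^d cancels against the
  normalisation of the test function, leaving s^(-d) and, by the support assumption, a finite sum
  over integer points.\<close>

lemma disc_pair_rescale:
  fixes V :: "real^'d \<Rightarrow> complex"
  assumes \<epsilon>: "\<epsilon> > 0" and s: "s > 0"
    and supp: "\<And>z. znorm z > n \<Longrightarrow> \<psi> (zemb (1 / s) z) = 0"
  shows "disc_pair \<epsilon> V (rescale \<psi> (zemb \<epsilon> x) (s * \<epsilon>))
    = complex_of_real (1 / s ^ CARD('d)) * (\<Sum>z\<in>zball n. V (zemb \<epsilon> (x + z)) * complex_of_real (\<psi> (zemb (1 / s) z)))"
proof -
  let ?g = "rescale \<psi> (zemb \<epsilon> x) (s * \<epsilon>)"
  define h where "h z = zemb \<epsilon> (x + z)" for z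
  have inj: "inj h" unfolding h_def by (rule injI, drule injD[OF inj_zemb[OF \<epsilon>]]) simp
  have range: "lattice \<epsilon> = range h"
  proof -
    have "zemb \<epsilon> z = h (z - x)" for z by (simp add: h_def)
    then have "range (zemb \<epsilon>) \<subseteq> range h" by (metis image_subsetI rangeI)
    then show ?thesis unfolding lattice_eq_range by (auto simp: h_def)
  qed
  have g: "?g (h z) = 1 / (s * \<epsilon>) ^ CARD('d) * \<psi> (zemb (1 / s) z)" for z
  proof -
    have "(1 / (s * \<epsilon>)) *\<^sub>R (h z - zemb \<epsilon> x) = zemb (1 / s) z"
      using \<epsilon> s by (simp add: h_def zemb_def vec_eq_iff field_simps)
    then show ?thesis by (simp add: rescale_def power_int_minus divide_inverse)
  qed
  have "(\<Sum>\<^sub>\<infinity>x\<in>lattice \<epsilon>. V x * complex_of_real (?g x)) = (\<Sum>\<^sub>\<infinity>z. V (h z) * complex_of_real (?g (h z)))"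
    unfolding range by (subst infsum_reindex[OF inj]) (simp add: o_def)
  also have "\<dots> = (\<Sum>\<^sub>\<infinity>z\<in>zball n. V (h z) * complex_of_real (?g (h z)))"
    by (rule infsum_cong_neutral) (auto simp: g supp)
  also have "\<dots> = (\<Sum>z\<in>zball n. V (h z) * complex_of_real (?g (h z)))"
    by (rule infsum_finite[OF finite_zball])
  also have "\<dots> = complex_of_real (1 / (s * \<epsilon>) ^ CARD('d)) * (\<Sum>z\<in>zball n. V (h z) * complex_of_real (\<psi> (zemb (1 / s) z)))"
    unfolding g by (simp add: sum_distrib_left mult_ac)
  finally show ?thesis
    unfolding disc_pair_def h_def using \<epsilon> s by (simp add: power_mult_distrib)
qed

text \<open>A monomial of degree at most one is constant or a single coordinate, and both satisfy
  the identity.\<close>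

lemma poly_le_1_midpoint:
  fixes P :: "real^'d \<Rightarrow> complex"
  assumes "poly_le 1 P"
  shows "P (a + z) + P (a - z) = 2 * P a"
proof -
  obtain c where c: "P = (\<lambda>z. \<Sum>\<beta>\<in>{\<beta>::'d\<Rightarrow>nat. (\<Sum>i\<in>UNIV. \<beta> i) \<le> 1}.
                c \<beta> * (\<Prod>i\<in>UNIV. (complex_of_real (z$i)) ^ (\<beta> i)))"
    using assms unfolding poly_le_def by blast
  define m where "m \<beta> z = (\<Prod>i\<in>UNIV. (complex_of_real (z$i)) ^ (\<beta> i))" for \<beta> :: "'d \<Rightarrow> nat" and z :: "real^'d"
  have m: "m \<beta> (a + z) + m \<beta> (a - z) = 2 * m \<beta> a" if \<beta>: "(\<Sum>i\<in>UNIV. \<beta> i) \<le> 1" for \<beta>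
  proof (cases "\<forall>i. \<beta> i = 0")
    case False
    then obtain i where i: "\<beta> i \<noteq> 0" by blast
    have "(\<Sum>l\<in>UNIV. \<beta> l) = \<beta> i + (\<Sum>l\<in>UNIV - {i}. \<beta> l)" by (rule sum.remove) auto
    then have "\<beta> i = 1" "(\<Sum>l\<in>UNIV - {i}. \<beta> l) = 0" using \<beta> i by linarith+
    then have b: "\<beta> i = 1" "\<And>l. l \<noteq> i \<Longrightarrow> \<beta> l = 0" by auto
    have "m \<beta> x = complex_of_real (x$i)" for x
    proof -
      have "m \<beta> x = (complex_of_real (x$i)) ^ \<beta> i * (\<Prod>l\<in>UNIV - {i}. (complex_of_real (x$l)) ^ \<beta> l)"
        unfolding m_def by (rule prod.remove) auto
      then show ?thesis by (simp add: b)
    qed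
    then show ?thesis by simp
  qed (simp add: m_def)
  show ?thesis
    unfolding c m_def[symmetric] sum.distrib[symmetric] sum_distrib_left
  proof (intro sum.cong refl)
    fix \<beta> :: "'d \<Rightarrow> nat" assume "\<beta> \<in> {\<beta>. (\<Sum>i\<in>UNIV. \<beta> i) \<le> 1}"
    then have "m \<beta> (a + z) + m \<beta> (a - z) = 2 * m \<beta> a" using m by simp
    then show "c \<beta> * m \<beta> (a + z) + c \<beta> * m \<beta> (a - z) = 2 * (c \<beta> * m \<beta> a)"
      by (metis distrib_left mult.left_commute)
  qed
qed

section \<open>Smoothing kernels obtained from test functions\<close>

lemma card_symmetric_interval: "card {- int n..int n} = 2 * n + 1"
  by simp

lemma zball_card_le: "card (zball n :: (int^'d) set) \<le> (2 * n + 1) ^ CARD('d)"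
proof -
  have "card (zball n :: (int^'d) set) \<le> card {z::int^'d. \<forall>i. z$i \<in> {- int n..int n}}"
  proof (rule card_mono)
    show "zball n \<subseteq> {z::int^'d. \<forall>i. z$i \<in> {- int n..int n}}"
    proof safe
      fix z :: "int^'d" and i assume "znorm z \<le> n"
      then show "z$i \<in> {- int n .. int n}" using component_le_znorm[of z i] by auto
    qed
  qed (rule zbox, simp)
  also have "\<dots> = (2 * n + 1) ^ CARD('d)" by (subst zbox) (simp_all add: card_symmetric_interval del: card_atLeastAtMost_int)
  finally show ?thesis .
qed

text \<open>Dividing by the discrete mass \<open>Z\<close> gives total mass exactly 1.
  \<open>Z\<close> is at least of order s^d, by counting lattice points in the cube where the test
  function exceeds m; the Laplacian is at most d B / s^2 at each of at most (7 s)^d points. In the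
  quotient the powers s^d cancel, so the constant does not depend on s, and 7 * 4 d produces 28
  d.\<close>

lemma smoothing_kernel_of_test_function:
  fixes \<psi> :: "real^'d \<Rightarrow> real"
  assumes m: "m > 0" and nn: "\<And>x. 0 \<le> \<psi> x" and sym: "\<And>x. \<psi> (- x) = \<psi> x"
    and supp: "\<And>x i. \<bar>x$i\<bar> \<ge> 1 / (2 * real CARD('d)) \<Longrightarrow> \<psi> x = 0"
    and low: "\<And>x. (\<forall>i. \<bar>x$i\<bar> \<le> 1 / (4 * real CARD('d))) \<Longrightarrow> m \<le> \<psi> x"
    and sd: "\<And>x i h. \<bar>\<psi> (x + axis i h) + \<psi> (x - axis i h) - 2 * \<psi> x\<bar> \<le> B * h\<^sup>2"
    and s: "s \<ge> 1"
  defines "d \<equiv> real CARD('d)"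
  defines "Z \<equiv> (\<Sum>z\<in>zball (nat \<lceil>s\<rceil>). \<psi> (zemb (1 / s) z))"
  shows "m / (4 * d) ^ CARD('d) * s ^ CARD('d) \<le> Z"
    and "smoothing_kernel ((28 * d) ^ CARD('d) * d * B / m) s (\<lambda>z. \<psi> (zemb (1 / s) z) / Z)"
    and "\<And>z. s \<le> real (znorm z) \<Longrightarrow> \<psi> (zemb (1 / s) z) = 0"
proof -
  have d1: "d \<ge> 1" unfolding d_def by (simp add: Suc_leI)
  have B: "B \<ge> 0" using sd[of 0 undefined 1] by simp
  define f where "f z = \<psi> (zemb (1 / s) z)" for z
  show zero: "f z = 0" if z: "s \<le> real (znorm z)" for z
  proof (rule ccontr)
    assume "f z \<noteq> 0"
    then have "\<bar>zemb (1 / s) z $ i\<bar> < 1 / (2 * d)" for i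
      using supp[of "zemb (1 / s) z" i] unfolding f_def d_def by (meson linorder_not_less)
    then have "\<bar>real_of_int (z$i)\<bar> \<le> s / (2 * d)" for i
      using s d1 by (simp add: zemb_def field_simps abs_mult less_imp_le)
    then have "real (znorm z) \<le> (\<Sum>i\<in>(UNIV::'d set). s / (2 * d))"
      unfolding real_znorm by (intro sum_mono)
    also have "\<dots> = s / 2" using d1 by (simp add: d_def)
    finally show False using z s by simp
  qed
  \<comment> \<open>Rounding down may give k = 0, but the box still has side 2 k + 1 \<ge> s / (4
    d), so the count holds for every s \<ge> 1.\<close>
  define k where "k = nat \<lfloor>s / (4 * d)\<rfloor>"
  define bx where "bx = {z::int^'d. \<forall>i. z$i \<in> {- int k..int k}}"
  have k: "real k \<le> s / (4 * d)" "s / (4 * d) \<le> 2 * real k + 1"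
  proof -
    have "\<lfloor>s / (4 * d)\<rfloor> \<ge> 0" using s d1 by simp
    then have "real k = real_of_int \<lfloor>s / (4 * d)\<rfloor>" "real k \<ge> 0" by (simp_all add: k_def)
    then show "real k \<le> s / (4 * d)" "s / (4 * d) \<le> 2 * real k + 1"
      using floor_correct[of "s / (4 * d)"] by linarith+
  qed
  have kd: "d * real k \<le> s" using mult_left_mono[OF k(1), of d] d1 s by simp
  have bxs: "bx \<subseteq> zball (nat \<lceil>s\<rceil>)"
  proof
    fix z assume "z \<in> bx"
    then have "znorm z \<le> CARD('d) * k" by (intro znorm_le_box) (auto simp: bx_def abs_le_iff minus_le_iff)
    moreover have "real (CARD('d) * k) \<le> s" using kd by (simp add: d_def)
    ultimately have "real (znorm z) \<le> s" by linarith
    then show "z \<in> zball (nat \<lceil>s\<rceil>)" by simp linarith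
  qed
  have "m * (s / (4 * d)) ^ CARD('d) \<le> m * real (card bx)"
  proof -
    have "card bx = (2 * k + 1) ^ CARD('d)" unfolding bx_def by (subst zbox) (simp_all add: card_symmetric_interval del: card_atLeastAtMost_int)
    then have "real (card bx) = (2 * real k + 1) ^ CARD('d)" by (simp add: add.commute)
    moreover have "(s / (4 * d)) ^ CARD('d) \<le> (2 * real k + 1) ^ CARD('d)"
      using k s d1 by (intro power_mono) auto
    ultimately show ?thesis using m by simp
  qed
  also have "\<dots> = (\<Sum>z\<in>bx. m)" by simp
  also have "\<dots> \<le> (\<Sum>z\<in>bx. f z)"
  proof (rule sum_mono)
    fix z assume "z \<in> bx"
    have "\<bar>zemb (1 / s) z $ i\<bar> \<le> 1 / (4 * d)" for i
    proof -
      have "\<bar>z$i\<bar> \<le> int k" using \<open>z \<in> bx\<close> by (auto simp: bx_def abs_le_iff minus_le_iff)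
      then have "\<bar>real_of_int (z$i)\<bar> \<le> s / (4 * d)" using k(1) by linarith
      then show ?thesis using s d1 by (simp add: zemb_def abs_mult field_simps)
    qed
    then show "m \<le> f z" unfolding f_def d_def by (intro low) auto
  qed
  also have "\<dots> \<le> Z" unfolding Z_def f_def by (rule sum_mono2[OF finite_zball bxs]) (auto simp: nn)
  finally have Zl: "m * (s / (4 * d)) ^ CARD('d) \<le> Z" .
  then show "m / (4 * d) ^ CARD('d) * s ^ CARD('d) \<le> Z" by (simp add: power_divide)
  have Zp: "Z > 0" using Zl m s d1 by (smt (verit) divide_pos_pos mult_pos_pos zero_less_power)
  have fl: "\<bar>zlap f z\<bar> \<le> d * (B / s\<^sup>2)" for z
  proof -
    have "\<bar>zlap f z\<bar> \<le> (\<Sum>j\<in>(UNIV::'d set). B * (1 / s)\<^sup>2)"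
      unfolding zlap_def f_def zemb_add zemb_diff zemb_unit
      by (rule order_trans[OF sum_abs]) (intro sum_mono sd)
    then show ?thesis by (simp add: d_def power_divide)
  qed
  have "(\<Sum>z\<in>zball (Suc (nat \<lceil>s\<rceil>)). \<bar>zlap f z\<bar>) \<le> (\<Sum>z\<in>(zball (Suc (nat \<lceil>s\<rceil>)) :: (int^'d) set). d * (B / s\<^sup>2))"
    by (intro sum_mono fl)
  also have "\<dots> = real (card (zball (Suc (nat \<lceil>s\<rceil>)) :: (int^'d) set)) * (d * (B / s\<^sup>2))" by simp
  also have "\<dots> \<le> (7 * s) ^ CARD('d) * (d * (B / s\<^sup>2))"
  proof (rule mult_right_mono)
    have "real (card (zball (Suc (nat \<lceil>s\<rceil>)) :: (int^'d) set)) \<le> real ((2 * Suc (nat \<lceil>s\<rceil>) + 1) ^ CARD('d))"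
      unfolding of_nat_le_iff by (rule zball_card_le)
    also have "\<dots> = (2 * real (Suc (nat \<lceil>s\<rceil>)) + 1) ^ CARD('d)" by simp
    \<comment> \<open>Here 2 (\<lceil>s\<rceil> + 1) + 1 \<le> 2 s + 5 \<le> 7 s.\<close>
    also have "\<dots> \<le> (7 * s) ^ CARD('d)"
      using s by (intro power_mono) (auto, linarith)
    finally show "real (card (zball (Suc (nat \<lceil>s\<rceil>)) :: (int^'d) set)) \<le> (7 * s) ^ CARD('d)" .
  qed (use d1 B in auto)
  finally have sl: "(\<Sum>z\<in>zball (Suc (nat \<lceil>s\<rceil>)). \<bar>zlap f z\<bar>) \<le> (7 * s) ^ CARD('d) * (d * (B / s\<^sup>2))" .
  have zlZ: "zlap (\<lambda>z. f z / Z) z = zlap f z / Z" for z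
    unfolding zlap_def sum_divide_distrib by (intro sum.cong) (auto simp: diff_divide_distrib add_divide_distrib)
  have "(\<Sum>z\<in>zball (Suc (nat \<lceil>s\<rceil>)). \<bar>zlap (\<lambda>z. f z / Z) z\<bar>) = (\<Sum>z\<in>zball (Suc (nat \<lceil>s\<rceil>)). \<bar>zlap f z\<bar>) / Z"
    unfolding zlZ using Zp by (simp add: sum_divide_distrib abs_divide)
  also have "\<dots> \<le> (7 * s) ^ CARD('d) * (d * (B / s\<^sup>2)) / (m * (s / (4 * d)) ^ CARD('d))"
    using sl Zl m s d1 B by (intro frac_le) auto
  also have "\<dots> = (28 * d) ^ CARD('d) * d * B / m / s\<^sup>2"
  proof -
    define p q where "p = (s / (4 * d)) ^ CARD('d)" and "q = (28 * d) ^ CARD('d)"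
    have "(7 * s) ^ CARD('d) = q * p"
      using d1 unfolding p_def q_def power_mult_distrib[symmetric] by simp
    moreover have "p > 0" using s d1 by (simp add: p_def)
    ultimately show ?thesis using m s unfolding p_def[symmetric] q_def[symmetric] by (simp add: field_simps)
  qed
  finally have "(\<Sum>z\<in>zball (Suc (nat \<lceil>s\<rceil>)). \<bar>zlap (\<lambda>z. f z / Z) z\<bar>) \<le> (28 * d) ^ CARD('d) * d * B / m / s\<^sup>2" .
  moreover have "f (- z) = f z" for z
  proof -
    have "zemb (1 / s) (- z) = - zemb (1 / s) z" by (simp add: zemb_def vec_eq_iff)
    then show ?thesis by (simp add: f_def sym)
  qed
  moreover have "(\<Sum>z\<in>zball (nat \<lceil>s\<rceil>). f z / Z) = 1"
    using Zp by (simp add: Z_def f_def flip: sum_divide_distrib)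
  ultimately show "smoothing_kernel ((28 * d) ^ CARD('d) * d * B / m) s (\<lambda>z. f z / Z)"
    unfolding smoothing_kernel_def using Zp nn zero by (auto simp: f_def)
qed

section \<open>Reduction to real germs and passage from the scaled lattice\<close>

lemma linear_double:
  fixes f :: "complex \<Rightarrow> real"
  assumes "linear f"
  shows "f (2 * w) = 2 * f w"
  using linear_scale[OF assms, of 2 w] by (simp add: scaleR_conv_of_real)

lemma zlap_linear:
  fixes f :: "complex \<Rightarrow> real"
  assumes "linear f"
  shows "zlap (\<lambda>z. f (u z)) y = f (zlap u y)"
  unfolding zlap_def
  by (simp add: linear_sum[OF assms] linear_add[OF assms] linear_diff[OF assms] linear_double[OF assms])

text \<open>All conditions on a germ are linear in its values, so a real-linear map that does not
  increase the modulus preserves them with the same constants. It is applied to \<open>Re\<close>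
  and \<open>Im\<close>.\<close>

lemma zgerm_of_complex_germ:
  fixes W :: "int^'d \<Rightarrow> int^'d \<Rightarrow> complex" and f :: "complex \<Rightarrow> real"
  assumes f: "linear f" "\<And>z. \<bar>f z\<bar> \<le> cmod z"
    and ex: "0 < \<alpha>" "\<alpha> < 1" "1 < \<eta>" "\<eta> < 2"
    and N: "0 < N" and H: "0 \<le> H" and K: "0 \<le> K" and c: "0 \<le> c"
    and kernel: "\<And>s. s \<ge> 1 \<Longrightarrow> smoothing_kernel c s (\<kappa> s)"
    and center: "\<And>x. W x x = 0" "\<And>x j. W x (x + zunit j) = 0"
    and growth: "\<And>x y. cmod (W x y) \<le> N * real (znorm (x - y)) powr \<eta>"
    and hoelder: "\<And>x y. \<exists>P. (\<forall>a z. P (a + z) + P (a - z) = 2 * P a) \<and>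
       (\<forall>z. cmod (W x z - W y z - P z)
          \<le> H * real (znorm (y - z)) powr \<alpha> * (real (znorm (x - y)) + real (znorm (y - z))) powr (\<eta> - \<alpha>))"
    and laplace: "\<And>x s. s \<ge> 1 \<Longrightarrow>
       cmod (\<Sum>z\<in>zball (nat \<lceil>s\<rceil>). zlap (W x) (x + z) * complex_of_real (\<kappa> s z)) \<le> K * s powr (\<eta> - 2)"
  shows "zgerm (\<lambda>x y. f (W x y)) \<kappa> \<alpha> \<eta> N H K c"
proof (unfold_locales; (fact ex N H K c)?)
  show "smoothing_kernel c s (\<kappa> s)" if "s \<ge> 1" for s by (rule kernel[OF that])
  show "f (W x x) = 0" "f (W x (x + zunit j)) = 0" for x j by (simp_all add: center linear_0[OF f(1)])
  show "\<bar>f (W x y)\<bar> \<le> N * real (znorm (x - y)) powr \<eta>" for x y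
    by (rule order_trans[OF f(2) growth])
  show "\<exists>P. (\<forall>a z. P (a + z) + P (a - z) = 2 * P a) \<and>
       (\<forall>z. \<bar>f (W x z) - f (W y z) - P z\<bar>
          \<le> H * real (znorm (y - z)) powr \<alpha> * (real (znorm (x - y)) + real (znorm (y - z))) powr (\<eta> - \<alpha>))" for x y
  proof -
    obtain P where P: "\<And>a z. P (a + z) + P (a - z) = 2 * P a" "\<And>z. cmod (W x z - W y z - P z)
          \<le> H * real (znorm (y - z)) powr \<alpha> * (real (znorm (x - y)) + real (znorm (y - z))) powr (\<eta> - \<alpha>)"
      using hoelder by blast
    show ?thesis
    proof (rule exI[of _ "\<lambda>z. f (P z)"], intro conjI allI)
      fix a z
      show "f (P (a + z)) + f (P (a - z)) = 2 * f (P a)"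
        using arg_cong[OF P(1)[of a z], of f] by (simp add: linear_double[OF f(1)] linear_add[OF f(1)])
      have "\<bar>f (W x z) - f (W y z) - f (P z)\<bar> \<le> cmod (W x z - W y z - P z)"
        using f(2)[of "W x z - W y z - P z"] by (simp add: linear_diff[OF f(1)])
      also note P(2)[of z]
      finally show "\<bar>f (W x z) - f (W y z) - f (P z)\<bar>
          \<le> H * real (znorm (y - z)) powr \<alpha> * (real (znorm (x - y)) + real (znorm (y - z))) powr (\<eta> - \<alpha>)" .
    qed
  qed
  show "\<bar>mollify s (\<kappa> s) (zlap (\<lambda>y. f (W x y))) x\<bar> \<le> K * s powr (\<eta> - 2)" if "s \<ge> 1" for x s
  proof -
    have "\<kappa> s z * f w = f (w * complex_of_real (\<kappa> s z))" for z w
      using linear_scale[OF f(1), of "\<kappa> s z" w] by (simp add: scaleR_conv_of_real mult.commute)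
    then have "mollify s (\<kappa> s) (zlap (\<lambda>y. f (W x y))) x
        = f (\<Sum>z\<in>zball (nat \<lceil>s\<rceil>). zlap (W x) (x + z) * complex_of_real (\<kappa> s z))"
      unfolding mollify_def zlap_linear[OF f(1)] by (simp add: linear_sum[OF f(1)])
    then show ?thesis using order_trans[OF f(2) laplace[OF that]] by simp
  qed
qed

text \<open>On integer coordinates N and H are multiplied by \<epsilon>^\<eta>, and K by
  \<epsilon>^\<eta> / D. All terms carry the same power of \<epsilon>, which returns as the scaling
  of \<open>l1dist\<close>; hence \<open>C\<close> is independent of \<epsilon>. One fixed test
  function provides the kernels at all scales.\<close>

lemma germ_improvement:
  fixes \<alpha> \<eta> :: real
  assumes ex: "0 < \<alpha>" "\<alpha> < 1" "1 < \<eta>" "\<eta> < 2"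
  shows "\<exists>C>0. \<forall>\<epsilon>>0. \<forall>(U :: real^'d \<Rightarrow> real^'d \<Rightarrow> complex) K N H.
     centered \<epsilon> U \<and> germ_neg \<epsilon> (\<eta> - 2) (germ_lap \<epsilon> U) \<le> ereal K \<and> 0 \<le> K \<and> 0 < N \<and> 0 < H \<and>
     (\<forall>x\<in>lattice \<epsilon>. \<forall>y\<in>lattice \<epsilon>. cmod (U x y) \<le> N * l1dist x y powr \<eta>) \<and>
     (\<forall>x\<in>lattice \<epsilon>. \<forall>y\<in>lattice \<epsilon>. \<exists>P. poly_le (nat \<lfloor>\<eta>\<rfloor>) P \<and>
        (\<forall>z\<in>lattice \<epsilon>. cmod (U x z - U y z - P z)
              \<le> H * l1dist y z powr \<alpha> * (l1dist x y + l1dist y z) powr (\<eta> - \<alpha>))) \<longrightarrow>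
     (\<forall>x\<in>lattice \<epsilon>. \<forall>y\<in>lattice \<epsilon>. cmod (U x y) \<le> (N / 2 + C * (K + H)) * l1dist x y powr \<eta>)"
proof -
  have "\<bar>\<eta> - 2\<bar> \<le> 1" using ex by simp
  then obtain \<psi> :: "real^'d \<Rightarrow> real" and m B where \<psi>: "\<psi> \<in> test_class (\<eta> - 2)" "m > 0" "\<And>x. 0 \<le> \<psi> x" "\<And>x. \<psi> (- x) = \<psi> x"
    "\<And>x i. \<bar>x$i\<bar> \<ge> 1 / (2 * real CARD('d)) \<Longrightarrow> \<psi> x = 0"
    "\<And>x. (\<forall>i. \<bar>x$i\<bar> \<le> 1 / (4 * real CARD('d))) \<Longrightarrow> m \<le> \<psi> x"
    "\<And>x i h. \<bar>\<psi> (x + axis i h) + \<psi> (x - axis i h) - 2 * \<psi> x\<bar> \<le> B * h\<^sup>2"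
    using test_function_exists[of "\<eta> - 2", where 'd = 'd] by metis
  define d where "d = real CARD('d)"
  have d1: "d \<ge> 1" unfolding d_def by (simp add: Suc_leI)
  define c where "c = (28 * d) ^ CARD('d) * d * B / m"
  define D where "D = m / (4 * d) ^ CARD('d)"
  define Z where "Z s = (\<Sum>z\<in>zball (nat \<lceil>s\<rceil>). \<psi> (zemb (1 / s) z))" for s
  define \<kappa> where "\<kappa> s z = \<psi> (zemb (1 / s) z) / Z s" for s z
  have B: "B \<ge> 0" using \<psi>(7)[of 0 undefined 1] by simp
  have c0: "c \<ge> 0" using B \<psi>(2) d1 by (simp add: c_def)
  have D0: "D > 0" using \<psi>(2) d1 by (simp add: D_def)
  have Z: "D * s ^ CARD('d) \<le> Z s" and \<kappa>: "smoothing_kernel c s (\<kappa> s)"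
    and \<psi>0: "\<And>z. s \<le> real (znorm z) \<Longrightarrow> \<psi> (zemb (1 / s) z) = 0" if "s \<ge> 1" for s
  proof -
    show "D * s ^ CARD('d) \<le> Z s" unfolding D_def Z_def d_def
      by (rule smoothing_kernel_of_test_function(1)[where B = B and \<psi> = \<psi>, OF \<psi>(2-4)]) (use \<psi>(5-7) that in blast)+
    show "smoothing_kernel c s (\<kappa> s)" unfolding c_def Z_def d_def \<kappa>_def[abs_def]
      by (rule smoothing_kernel_of_test_function(2)[where B = B and \<psi> = \<psi>, OF \<psi>(2-4)]) (use \<psi>(5-7) that in blast)+
    show "\<psi> (zemb (1 / s) z) = 0" if "s \<le> real (znorm z)" for z
      by (rule smoothing_kernel_of_test_function(3)[where B = B and \<psi> = \<psi>, OF \<psi>(2-4)]) (use \<psi>(5-7) \<open>s \<ge> 1\<close> that in blast)+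
  qed
  obtain C0 where C0: "C0 > 0" "\<And>(U :: int^'d \<Rightarrow> int^'d \<Rightarrow> real) \<kappa> N H K x y. zgerm U \<kappa> \<alpha> \<eta> N H K c \<Longrightarrow>
     \<bar>U x y\<bar> \<le> (N / 4 + C0 * (K + H)) * real (znorm (x - y)) powr \<eta>"
    using zgerm_improvement[OF ex c0] by blast
  \<comment> \<open>The 2 comes from adding real and imaginary parts; 1 / D is the cost of replacing
    the weight s^(-d) in the pairing by the normalisation 1 / Z s, and the summand 1 serves the
    Hoelder constant.\<close>
  define C where "C = 2 * C0 * (1 / D + 1)"
  have "C > 0" using C0(1) D0 by (simp add: C_def add_pos_pos)
  show ?thesis
  proof (rule exI[of _ C], intro conjI allI impI ballI \<open>C > 0\<close>, elim conjE)
    fix \<epsilon> :: real and U :: "real^'d \<Rightarrow> real^'d \<Rightarrow> complex" and K N H and x y :: "real^'d"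
    assume \<epsilon>: "\<epsilon> > 0" and cen: "centered \<epsilon> U" and neg: "germ_neg \<epsilon> (\<eta> - 2) (germ_lap \<epsilon> U) \<le> ereal K"
      and K: "0 \<le> K" and N: "0 < N" and H: "0 < H"
      and gr: "\<forall>x\<in>lattice \<epsilon>. \<forall>y\<in>lattice \<epsilon>. cmod (U x y) \<le> N * l1dist x y powr \<eta>"
      and ho: "\<forall>x\<in>lattice \<epsilon>. \<forall>y\<in>lattice \<epsilon>. \<exists>P. poly_le (nat \<lfloor>\<eta>\<rfloor>) P \<and>
        (\<forall>z\<in>lattice \<epsilon>. cmod (U x z - U y z - P z)
              \<le> H * l1dist y z powr \<alpha> * (l1dist x y + l1dist y z) powr (\<eta> - \<alpha>))"
      and xy: "x \<in> lattice \<epsilon>" "y \<in> lattice \<epsilon>"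
    define W where "W a b = U (zemb \<epsilon> a) (zemb \<epsilon> b)" for a b
    define E where "E = \<epsilon> powr \<eta>"
    have E: "E > 0" using \<epsilon> by (simp add: E_def)
    have "nat \<lfloor>\<eta>\<rfloor> = 1" using ex by (simp add: nat_eq_iff floor_eq_iff)
    have lap: "cmod (\<Sum>z\<in>zball (nat \<lceil>s\<rceil>). zlap (W a) (a + z) * complex_of_real (\<kappa> s z)) \<le> (K / D * E) * s powr (\<eta> - 2)"
      if s: "s \<ge> 1" for a s
    proof -
      define S where "S = (\<Sum>z\<in>zball (nat \<lceil>s\<rceil>). zlap (W a) (a + z) * complex_of_real (\<psi> (zemb (1 / s) z)))"
      have s0: "s > 0" and sd: "s ^ CARD('d) > 0" using s by simp_all
      have supp: "\<psi> (zemb (1 / s) z) = 0" if "znorm z > nat \<lceil>s\<rceil>" for z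
        using \<psi>0[OF s, of z] that by linarith
      have L: "germ_lap \<epsilon> U (zemb \<epsilon> a) (zemb \<epsilon> b) = complex_of_real (\<epsilon> powi (-2)) * zlap (W a) b" for b
        unfolding germ_lap_def disc_lap_zemb[OF \<epsilon>] W_def ..
      have pair: "disc_pair \<epsilon> (germ_lap \<epsilon> U (zemb \<epsilon> a)) (rescale \<psi> (zemb \<epsilon> a) (s * \<epsilon>))
          = complex_of_real (1 / s ^ CARD('d)) * (complex_of_real (\<epsilon> powi (-2)) * S)"
        using disc_pair_rescale[where \<psi> = \<psi> and s = s and V = "germ_lap \<epsilon> U (zemb \<epsilon> a)" and x = a, OF \<epsilon> s0 supp]
        unfolding L S_def by (simp add: sum_distrib_left mult_ac)
      \<comment> \<open>The radius s \<epsilon> is admissible precisely because s \<ge> 1.\<close>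
      have "ereal ((s * \<epsilon>) powr (- (\<eta> - 2)) * cmod (disc_pair \<epsilon> (germ_lap \<epsilon> U (zemb \<epsilon> a)) (rescale \<psi> (zemb \<epsilon> a) (s * \<epsilon>))))
          \<le> germ_neg \<epsilon> (\<eta> - 2) (germ_lap \<epsilon> U)"
        unfolding germ_neg_def using \<psi>(1) s \<epsilon> by (intro Sup_upper) fastforce
      also note neg
      finally have "(s * \<epsilon>) powr (- (\<eta> - 2)) * (1 / s ^ CARD('d) * (1 / \<epsilon>\<^sup>2 * cmod S)) \<le> K"
        unfolding pair using s \<epsilon> by (simp add: norm_mult norm_divide norm_power power_int_minus divide_inverse norm_inverse)
      then have "(s * \<epsilon>) powr (\<eta> - 2) * ((s * \<epsilon>) powr (- (\<eta> - 2)) * (1 / s ^ CARD('d) * (1 / \<epsilon>\<^sup>2 * cmod S))) \<le> (s * \<epsilon>) powr (\<eta> - 2) * K"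
        by (rule mult_left_mono) simp
      moreover have "(s * \<epsilon>) powr (\<eta> - 2) * (s * \<epsilon>) powr (- (\<eta> - 2)) = 1"
        using s \<epsilon> by (simp flip: powr_add)
      ultimately have "1 / s ^ CARD('d) * (1 / \<epsilon>\<^sup>2 * cmod S) \<le> (s * \<epsilon>) powr (\<eta> - 2) * K"
        by (metis mult.assoc mult_1)
      \<comment> \<open>The \<epsilon>^(-2) here cancels the one in the discrete Laplacian, leaving
        \<open>E = \<epsilon> powr \<eta>\<close>.\<close>
      moreover have "(s * \<epsilon>) powr (\<eta> - 2) = s powr (\<eta> - 2) * E / \<epsilon>\<^sup>2"
        using s \<epsilon> by (simp add: powr_mult E_def powr_diff)
      ultimately have "cmod S \<le> s ^ CARD('d) * (s powr (\<eta> - 2) * E * K)"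
        using \<epsilon> sd by (simp add: field_simps)
      moreover have "(\<Sum>z\<in>zball (nat \<lceil>s\<rceil>). zlap (W a) (a + z) * complex_of_real (\<kappa> s z)) = S / complex_of_real (Z s)"
        by (simp add: S_def \<kappa>_def sum_divide_distrib)
      moreover have "Z s > 0" using Z[OF s] D0 sd by (smt (verit) mult_pos_pos)
      ultimately have "cmod (\<Sum>z\<in>zball (nat \<lceil>s\<rceil>). zlap (W a) (a + z) * complex_of_real (\<kappa> s z))
          \<le> s ^ CARD('d) * (s powr (\<eta> - 2) * E * K) / Z s"
        by (simp add: norm_divide divide_right_mono)
      also have "\<dots> \<le> s ^ CARD('d) * (s powr (\<eta> - 2) * E * K) / (D * s ^ CARD('d))"
        using Z[OF s] D0 sd K E by (intro divide_left_mono) (auto intro!: mult_pos_pos \<open>Z s > 0\<close>)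
      also have "\<dots> = (K / D * E) * s powr (\<eta> - 2)" using sd D0 by (simp add: field_simps)
      finally show ?thesis .
    qed
    have l1: "l1dist (zemb \<epsilon> a) (zemb \<epsilon> b) powr \<eta> = E * real (znorm (a - b)) powr \<eta>" for a b :: "int^'d"
      using \<epsilon> by (simp add: l1dist_zemb E_def powr_mult)
    have zg: "zgerm (\<lambda>x y. f (W x y)) \<kappa> \<alpha> \<eta> (N * E) (H * E) (K / D * E) c"
      if f: "linear f" "\<And>z. \<bar>f z\<bar> \<le> cmod z" for f :: "complex \<Rightarrow> real"
    proof (rule zgerm_of_complex_germ[OF f ex])
      show "W a a = 0" for a using cen by (simp add: centered_def W_def)
      show "W a (a + zunit j) = 0" for a j
      proof -
        have e: "zemb \<epsilon> (a + zunit j) = zemb \<epsilon> a + \<epsilon> *\<^sub>R axis j 1"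
          by (simp add: zemb_add zemb_unit axis_def vec_eq_iff)
        show ?thesis using cen \<epsilon> unfolding centered_def W_def e by (auto simp: zemb_in_lattice)
      qed
      show "cmod (W a b) \<le> N * E * real (znorm (a - b)) powr \<eta>" for a b
        using gr l1[of a b] unfolding W_def by (metis mult.assoc zemb_in_lattice)
      show "\<exists>P. (\<forall>a z. P (a + z) + P (a - z) = 2 * P a) \<and>
       (\<forall>z. cmod (W a z - W b z - P z)
          \<le> H * E * real (znorm (b - z)) powr \<alpha> * (real (znorm (a - b)) + real (znorm (b - z))) powr (\<eta> - \<alpha>))" for a b
      proof -
        obtain P where P: "poly_le 1 P" "\<And>z. z\<in>lattice \<epsilon> \<Longrightarrow> cmod (U (zemb \<epsilon> a) z - U (zemb \<epsilon> b) z - P z)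
              \<le> H * l1dist (zemb \<epsilon> b) z powr \<alpha> * (l1dist (zemb \<epsilon> a) (zemb \<epsilon> b) + l1dist (zemb \<epsilon> b) z) powr (\<eta> - \<alpha>)"
          using ho[unfolded \<open>nat \<lfloor>\<eta>\<rfloor> = 1\<close>] zemb_in_lattice by blast
        show ?thesis
        proof (rule exI[of _ "\<lambda>z. P (zemb \<epsilon> z)"], intro conjI allI)
          show "P (zemb \<epsilon> (u + z)) + P (zemb \<epsilon> (u - z)) = 2 * P (zemb \<epsilon> u)" for u z
            unfolding zemb_add zemb_diff by (rule poly_le_1_midpoint[OF P(1)])
          fix z
          have "(\<epsilon> * real (znorm (b - z))) powr \<alpha> * (\<epsilon> * real (znorm (a - b)) + \<epsilon> * real (znorm (b - z))) powr (\<eta> - \<alpha>)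
            = (\<epsilon> powr \<alpha> * \<epsilon> powr (\<eta> - \<alpha>)) * (real (znorm (b - z)) powr \<alpha> * (real (znorm (a - b)) + real (znorm (b - z))) powr (\<eta> - \<alpha>))"
            using \<epsilon> by (simp add: powr_mult flip: distrib_left)
          also have "\<epsilon> powr \<alpha> * \<epsilon> powr (\<eta> - \<alpha>) = E" by (simp add: E_def flip: powr_add)
          finally show "cmod (W a z - W b z - P (zemb \<epsilon> z))
            \<le> H * E * real (znorm (b - z)) powr \<alpha> * (real (znorm (a - b)) + real (znorm (b - z))) powr (\<eta> - \<alpha>)"
            using P(2)[OF zemb_in_lattice, of z] unfolding l1dist_zemb[OF \<epsilon>] W_def by (simp only: mult.assoc)
        qed
      qed
    qed (use N H K E D0 c0 \<kappa> lap in auto)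
    obtain a b where ab: "x = zemb \<epsilon> a" "y = zemb \<epsilon> b" using xy by (auto simp: lattice_eq_range)
    define n where "n = real (znorm (a - b)) powr \<eta>"
    have bd: "\<bar>f (W a b)\<bar> \<le> (N * E / 4 + C0 * (K / D * E + H * E)) * n"
      if "linear f" "\<And>z. \<bar>f z\<bar> \<le> cmod z" for f :: "complex \<Rightarrow> real"
      using C0(2)[OF zg[OF that]] unfolding n_def by blast
    have "cmod (W a b) \<le> \<bar>Re (W a b)\<bar> + \<bar>Im (W a b)\<bar>" by (rule cmod_le)
    also have "\<dots> \<le> 2 * ((N * E / 4 + C0 * (K / D * E + H * E)) * n)"
      unfolding mult_2
      by (intro add_mono bd[of Re] bd[of Im] bounded_linear.linear bounded_linear_Re bounded_linear_Im abs_Re_le_cmod abs_Im_le_cmod)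
    also have "\<dots> = (N / 2 + 2 * C0 * (K / D + H)) * (E * n)" by (simp add: algebra_simps)
    also have "\<dots> \<le> (N / 2 + C * (K + H)) * (E * n)"
    proof (rule mult_right_mono)
      have "(1 / D + 1) * (K + H) = K / D + H + (H / D + K)" by (simp add: algebra_simps add_divide_distrib)
      moreover have "H / D \<ge> 0" using H D0 by simp
      ultimately have "K / D + H \<le> (1 / D + 1) * (K + H)" using K by linarith
      then have "2 * C0 * (K / D + H) \<le> 2 * C0 * ((1 / D + 1) * (K + H))" using C0(1) by (intro mult_left_mono) auto
      then show "N / 2 + 2 * C0 * (K / D + H) \<le> N / 2 + C * (K + H)" by (simp add: C_def mult.assoc)
    qed (use E in \<open>simp add: n_def\<close>)
    finally show "cmod (U x y) \<le> (N / 2 + C * (K + H)) * l1dist x y powr \<eta>"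
      by (simp add: ab W_def l1 n_def)
  qed
qed

text \<open>In \<open>ereal\<close> the supremum of the empty set is minus infinity, so
  nonnegativity rests on the existence of a test function; radius \<epsilon> at the origin provides
  a member of the set.\<close>

lemma germ_neg_nonneg:
  fixes V :: "real^'d \<Rightarrow> real^'d \<Rightarrow> complex"
  assumes "\<bar>\<gamma>\<bar> \<le> 1"
  shows "0 \<le> germ_neg \<epsilon> \<gamma> V"
proof -
  obtain \<phi> :: "real^'d \<Rightarrow> real" where "\<phi> \<in> test_class \<gamma>" using test_function_exists[OF assms] by blast
  then have "ereal (\<epsilon> powr (- \<gamma>) * cmod (disc_pair \<epsilon> (V (zemb \<epsilon> 0)) (rescale \<phi> (zemb \<epsilon> 0) \<epsilon>))) \<le> germ_neg \<epsilon> \<gamma> V"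
    unfolding germ_neg_def by (intro Sup_upper CollectI) (metis order_refl zemb_in_lattice)
  moreover have "0 \<le> ereal (\<epsilon> powr (- \<gamma>) * cmod (disc_pair \<epsilon> (V (zemb \<epsilon> 0)) (rescale \<phi> (zemb \<epsilon> 0) \<epsilon>)))" by simp
  ultimately show ?thesis by (rule order_trans[rotated])
qed

theorem theorem2p11:
  fixes \<alpha> \<eta> :: real
  assumes "0 < \<alpha>" "\<alpha> < 1" "1 < \<eta>" "\<eta> < 2"
  shows "\<exists>C>0. \<forall>\<epsilon>>0. \<forall>U :: real^'d \<Rightarrow> real^'d \<Rightarrow> complex.
     centered \<epsilon> U \<and> germ_norm (lattice \<epsilon>) \<eta> U < \<infinity> \<longrightarrow>
     germ_norm (lattice \<epsilon>) \<eta> U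
       \<le> ereal C * (germ_neg \<epsilon> (\<eta> - 2) (germ_lap \<epsilon> U) + germ_hoelder (lattice \<epsilon>) \<eta> \<alpha> U)"
proof -
  obtain C where C: "C > 0" and improve: "\<And>\<epsilon> (U :: real^'d \<Rightarrow> real^'d \<Rightarrow> complex) K N H x y. \<lbrakk>\<epsilon> > 0; centered \<epsilon> U;
     germ_neg \<epsilon> (\<eta> - 2) (germ_lap \<epsilon> U) \<le> ereal K; 0 \<le> K; 0 < N; 0 < H;
     \<forall>x\<in>lattice \<epsilon>. \<forall>y\<in>lattice \<epsilon>. cmod (U x y) \<le> N * l1dist x y powr \<eta>;
     \<forall>x\<in>lattice \<epsilon>. \<forall>y\<in>lattice \<epsilon>. \<exists>P. poly_le (nat \<lfloor>\<eta>\<rfloor>) P \<and>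
        (\<forall>z\<in>lattice \<epsilon>. cmod (U x z - U y z - P z)
              \<le> H * l1dist y z powr \<alpha> * (l1dist x y + l1dist y z) powr (\<eta> - \<alpha>));
     x \<in> lattice \<epsilon>; y \<in> lattice \<epsilon>\<rbrakk> \<Longrightarrow> cmod (U x y) \<le> (N / 2 + C * (K + H)) * l1dist x y powr \<eta>"
    using germ_improvement[OF assms, where 'd = 'd] by metis
  show ?thesis
  proof (rule exI[of _ "2 * C"], intro conjI allI impI, use C in simp, elim conjE)
    fix \<epsilon> :: real and U :: "real^'d \<Rightarrow> real^'d \<Rightarrow> complex"
    assume \<epsilon>: "\<epsilon> > 0" and cen: "centered \<epsilon> U" and fin: "germ_norm (lattice \<epsilon>) \<eta> U < \<infinity>"
    define SN SH where "SN = {M. M > 0 \<and> (\<forall>x\<in>lattice \<epsilon>. \<forall>y\<in>lattice \<epsilon>. cmod (U x y) \<le> M * l1dist x y powr \<eta>)}"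
      and "SH = {M. M > 0 \<and> (\<forall>x\<in>lattice \<epsilon>. \<forall>y\<in>lattice \<epsilon>. \<exists>P. poly_le (nat \<lfloor>\<eta>\<rfloor>) P \<and>
        (\<forall>z\<in>lattice \<epsilon>. cmod (U x z - U y z - P z)
              \<le> M * l1dist y z powr \<alpha> * (l1dist x y + l1dist y z) powr (\<eta> - \<alpha>)))}"
    have gn: "germ_norm (lattice \<epsilon>) \<eta> U = Inf (ereal ` SN)"
      unfolding germ_norm_def SN_def by (intro arg_cong[of _ _ Inf]) auto
    have gh: "germ_hoelder (lattice \<epsilon>) \<eta> \<alpha> U = Inf (ereal ` SH)"
      unfolding germ_hoelder_def SH_def by (intro arg_cong[of _ _ Inf]) auto
    have n0: "0 \<le> germ_norm (lattice \<epsilon>) \<eta> U" unfolding gn by (intro Inf_greatest) (auto simp: SN_def)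
    have h0: "0 \<le> germ_hoelder (lattice \<epsilon>) \<eta> \<alpha> U" unfolding gh by (intro Inf_greatest) (auto simp: SH_def)
    have k0: "0 \<le> germ_neg \<epsilon> (\<eta> - 2) (germ_lap \<epsilon> U)" by (rule germ_neg_nonneg) (use assms in simp)
    show "germ_norm (lattice \<epsilon>) \<eta> U
       \<le> ereal (2 * C) * (germ_neg \<epsilon> (\<eta> - 2) (germ_lap \<epsilon> U) + germ_hoelder (lattice \<epsilon>) \<eta> \<alpha> U)"
    proof (cases "germ_neg \<epsilon> (\<eta> - 2) (germ_lap \<epsilon> U) = \<infinity> \<or> germ_hoelder (lattice \<epsilon>) \<eta> \<alpha> U = \<infinity>")
      case True
      then have inf: "germ_neg \<epsilon> (\<eta> - 2) (germ_lap \<epsilon> U) + germ_hoelder (lattice \<epsilon>) \<eta> \<alpha> U = \<infinity>" by auto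
      show ?thesis unfolding inf using C by simp
    next
      case False
      then obtain k where k: "germ_neg \<epsilon> (\<eta> - 2) (germ_lap \<epsilon> U) = ereal k" "k \<ge> 0"
        using k0 by (cases "germ_neg \<epsilon> (\<eta> - 2) (germ_lap \<epsilon> U)") auto
      obtain h where h: "germ_hoelder (lattice \<epsilon>) \<eta> \<alpha> U = ereal h"
        using h0 False by (cases "germ_hoelder (lattice \<epsilon>) \<eta> \<alpha> U") auto
      obtain g where g: "germ_norm (lattice \<epsilon>) \<eta> U = ereal g"
        using n0 fin by (cases "germ_norm (lattice \<epsilon>) \<eta> U") auto
      \<comment> \<open>Near-optimal constants N < g + t and H < h + t replace the infima. The
        improved constant is again admissible, so g is at most (g + t) / 2 + C (k + h + t), and g /
        2 can be absorbed because g is finite. The remaining error is (1 + 2 C) t, whence the choice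
        of \<open>t\<close>.\<close>
      have "g \<le> 2 * C * (k + h) + e" if e: "e > 0" for e
      proof -
        define t where "t = e / (1 + 2 * C)"
        have t: "t > 0" using e C by (simp add: t_def)
        have "Inf (ereal ` SN) < ereal (g + t)" using g t unfolding gn by simp
        then obtain N where N: "N \<in> SN" "N < g + t" by (auto simp: Inf_less_iff)
        have "Inf (ereal ` SH) < ereal (h + t)" using h t unfolding gh by simp
        then obtain H where H: "H \<in> SH" "H < h + t" by (auto simp: Inf_less_iff)
        have pos: "N > 0" "H > 0" using N(1) H(1) by (auto simp: SN_def SH_def)
        have "cmod (U x y) \<le> (N / 2 + C * (k + H)) * l1dist x y powr \<eta>" if "x \<in> lattice \<epsilon>" "y \<in> lattice \<epsilon>" for x y
          by (rule improve[OF \<epsilon> cen]) (use k N(1) H(1) that in \<open>auto simp: SN_def SH_def\<close>)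
        moreover have "N / 2 + C * (k + H) > 0" using pos k(2) C by (intro add_pos_nonneg) auto
        ultimately have "N / 2 + C * (k + H) \<in> SN" by (simp add: SN_def)
        then have "Inf (ereal ` SN) \<le> ereal (N / 2 + C * (k + H))" by (intro Inf_lower imageI)
        then have "g \<le> N / 2 + C * (k + H)" using g unfolding gn by simp
        also have "\<dots> \<le> (g + t) / 2 + C * (k + (h + t))"
          using N(2) H(2) C by (intro add_mono divide_right_mono mult_left_mono) auto
        finally have "g \<le> (g + t) / 2 + C * (k + (h + t))" .
        then have "g \<le> 2 * (C * (k + (h + t))) + t" by (simp only: field_simps)
        then have "g \<le> 2 * C * (k + h) + (1 + 2 * C) * t" by (simp add: algebra_simps)
        also have "(1 + 2 * C) * t = e" using C by (simp add: t_def)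
        finally show ?thesis .
      qed
      then have "g \<le> 2 * C * (k + h)" by (rule field_le_epsilon)
      then show ?thesis by (simp add: g k h)
    qed
  qed
qed

end
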